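(* Let $u\in\mathcal{L}(\mathbb{C}^n)$ and $x\in\mathbb{C}^n$. Then: (a) $\nu(u,\infty)=\nu(\Psi_{u,x},\infty)=\psi_{u,x}(\mathbf{1})$; (b) $\nu(u,a,\infty)=\nu(\Psi_{u,x},a,\infty)=\psi_{u,x}(a)$ for all $a\in\mathbb{R}^n_+$; (c) $\sigma_k(u)=\sigma_k(\Psi_{u,x})=\psi_{u,x}(\mathbf{1}_k)$ for $k=1,\dots,n$.
   Context: Plurisubharmonic functions are, as usual, not identically $-\infty$. $\mathcal{L}=\mathcal{L}(\mathbb{C}^n)$ is the class of plurisubharmonic functions $u$ on $\mathbb{C}^n$ with $u(z)\le C_1\log^+|z|+C_2$ for all $z$, for some constants $C_1,C_2\ge0$ depending on $u$. For $u\in\mathcal{L}$, $x\in\mathbb{C}^n$, $t\in\mathbb{R}^n$, let $g'(u,x,t)$ be the maximum of $u$ on $\{z:|z_k-x_k|=e^{t_k},\ 1\le k\le n\}$, and $\psi_{u,x}(t)=\lim_{R\to+\infty}R^{-1}g'(u,x,Rt)$ (the limit exists and is finite). The indicator of $u$ at $x$ is the function $\Psi_{u,x}\in\mathcal{L}$ given by $\Psi_{u,x}(y)=\psi_{u,x}(\log|y_1|,\dots,\log|y_n|)$ for $y_1\cdots y_n\neq0$, extended (uniquely) to a plurisubharmonic function on $\mathbb{C}^n$. Growth characteristics of $u\in\mathcal{L}$: the logarithmic type (Lelong number at infinity) is $\nu(u,\infty)=\sigma(u)=\limsup_{z\to\infty}u(z)/\log|z|$. For $a\in\mathbb{R}^n_+$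 (all $a_k>0$), the directional Lelong number at infinity is $\nu(u,a,\infty)=\limsup_{z\to\infty}u(z)/S_a(z)$, where $S_a(z)=\sup_k a_k^{-1}\log|z_k|$. The logarithmic multitype $(\sigma_1(u),\dots,\sigma_n(u))$ is defined by: $\sigma_k(u)$ is the supremum, over all choices of fixed values in $\mathbb{C}^{n-1}$ of the variables $z_j$, $j\ne k$, of the logarithmic type $\limsup_{z_k\to\infty}u(z)/\log|z_k|$ of $u$ as a function of $z_k\in\mathbb{C}$ alone. Finally $\mathbf{1}=(1,\dots,1)\in\mathbb{R}^n$ and $\mathbf{1}_k$ is the $k$-th standard basis vector of $\mathbb{R}^n$. *)

theory Defs
  imports "HOL-Analysis.Analysis"
begin

text \<open>
  Points of \<open>\<complex>\<^sup>n\<close> are vectors of type \<open>complex ^ 'n\<close>, and points of \<open>\<real>\<^sup>n\<close> vectors of type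
  \<open>real ^ 'n\<close>; functions with values in \<open>[-\<infinity>, \<infinity>)\<close> are \<open>ereal\<close>-valued.
\<close>

definition upper_semicont :: "('a::topological_space \<Rightarrow> ereal) \<Rightarrow> bool" where
  "upper_semicont v \<longleftrightarrow> (\<forall>c. open {z. v z < c})"

text \<open>
  The Lebesgue integral of an extended-real function is the integral of its positive part minus
  that of its negative part; \<open>e2ennreal\<close> sends negative values to \<open>0\<close>.  For upper semicontinuous
  functions with values below \<open>\<infinity>\<close>, the first integral over a circle is finite, so that
  \<open>\<infinity> - \<infinity>\<close> does not occur, while the value \<open>-\<infinity>\<close> is possible.
\<close>

definition circle_mean :: "(complex \<Rightarrow> ereal) \<Rightarrow> complex \<Rightarrow> real \<Rightarrow> ereal" where
  "circle_mean v c r =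
     (enn2ereal (\<integral>\<^sup>+\<theta>\<in>{0..2 * pi}. e2ennreal (v (c + of_real r * cis \<theta>)) \<partial>lborel)
      - enn2ereal (\<integral>\<^sup>+\<theta>\<in>{0..2 * pi}. e2ennreal (- v (c + of_real r * cis \<theta>)) \<partial>lborel))
     / ereal (2 * pi)"

text \<open>The constant \<open>-\<infinity>\<close> is admitted here, as a restriction of a plurisubharmonic function to a
  complex line may be identically \<open>-\<infinity>\<close>.\<close>

definition subharmonic :: "(complex \<Rightarrow> ereal) \<Rightarrow> bool" where
  "subharmonic v \<longleftrightarrow> upper_semicont v \<and> (\<forall>z. v z < \<infinity>) \<and> (\<forall>c. \<forall>r>0. v c \<le> circle_mean v c r)"

definition plurisubharmonic :: "(complex ^ 'n \<Rightarrow> ereal) \<Rightarrow> bool" where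
  "plurisubharmonic u \<longleftrightarrow>
     upper_semicont u \<and> (\<forall>z. u z < \<infinity>) \<and> (\<exists>z. u z \<noteq> -\<infinity>) \<and>
     (\<forall>a b. subharmonic (\<lambda>w. u (a + w *s b)))"

definition Lclass :: "(complex ^ 'n \<Rightarrow> ereal) set" where
  "Lclass = {u. plurisubharmonic u \<and>
     (\<exists>C\<^sub>1\<ge>0. \<exists>C\<^sub>2\<ge>0. \<forall>z. u z \<le> ereal (C\<^sub>1 * max 0 (ln (norm z)) + C\<^sub>2))}"

definition torus_max :: "(complex ^ 'n \<Rightarrow> ereal) \<Rightarrow> complex ^ 'n \<Rightarrow> real ^ 'n \<Rightarrow> ereal" where
  "torus_max u x t = (SUP z \<in> {z. \<forall>k. cmod (z $ k - x $ k) = exp (t $ k)}. u z)"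

definition psi :: "(complex ^ 'n \<Rightarrow> ereal) \<Rightarrow> complex ^ 'n \<Rightarrow> real ^ 'n \<Rightarrow> ereal" where
  "psi u x t = Lim at_top (\<lambda>R::real. torus_max u x (R *\<^sub>R t) / ereal R)"

definition local_indicator ::
    "(complex ^ 'n \<Rightarrow> ereal) \<Rightarrow> complex ^ 'n \<Rightarrow> complex ^ 'n \<Rightarrow> ereal" where
  "local_indicator u x =
     (THE v. plurisubharmonic v \<and>
        (\<forall>y. (\<forall>k. y $ k \<noteq> 0) \<longrightarrow> v y = psi u x (\<chi> k. ln (cmod (y $ k)))))"

definition log_type :: "('a::real_normed_vector \<Rightarrow> ereal) \<Rightarrow> ereal" where
  "log_type u = Limsup at_infinity (\<lambda>z. u z / ereal (ln (norm z)))"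

text \<open>Logarithm with \<open>log 0 = -\<infinity>\<close> (the library has \<open>ln 0 = 0\<close>).\<close>

definition elog :: "real \<Rightarrow> ereal" where
  "elog r = (if r = 0 then -\<infinity> else ereal (ln r))"

definition S_dir :: "real ^ 'n \<Rightarrow> complex ^ 'n \<Rightarrow> ereal" where
  "S_dir a z = (SUP k. ereal (inverse (a $ k)) * elog (cmod (z $ k)))"

definition dir_lelong :: "(complex ^ 'n \<Rightarrow> ereal) \<Rightarrow> real ^ 'n \<Rightarrow> ereal" where
  "dir_lelong u a = Limsup at_infinity (\<lambda>z. u z / S_dir a z)"

text \<open>In the supremum, the \<open>k\<close>-th coordinate of \<open>z\<close> is irrelevant: \<open>z\<close> only supplies the
  fixed values of the other variables.\<close>

definition multitype :: "(complex ^ 'n \<Rightarrow> ereal) \<Rightarrow> 'n \<Rightarrow> ereal" where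
  "multitype u k = (SUP z. log_type (\<lambda>w::complex. u (\<chi> j. if j = k then w else z $ j)))"

end

theory Submission
  imports Defs "HOL-Complex_Analysis.Cauchy_Integral_Formula" "HOL-Real_Asymp.Real_Asymp"
begin

text \<open>
  Write \<open>F(t)\<close> for the maximum of \<open>u\<close> on the torus \<open>|z\<^sub>k - x\<^sub>k| = e\<^bsup>t\<^sub>k\<^esup>\<close>.  The maximum
  principle bounds \<open>u\<close> on the whole polydisc by \<open>F(t)\<close>, and \<open>F\<close> is a finite, coordinatewise
  nondecreasing, convex function of \<open>t\<close> (Hadamard's three circles theorem in several variables).
  Convexity and logarithmic growth make \<open>\<psi>(t) = lim F(R t) / R\<close> the recession function of \<open>F\<close>, so
  that \<open>F(R t) \<le> F(0) + R \<psi>(t)\<close> for all \<open>R \<ge> 0\<close>.  The three growth characteristics of \<open>u\<close> are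
  then read off from \<open>\<psi>\<close>.

  For \<open>\<sigma>(u)\<close> and \<open>\<nu>(u, a, \<infinity>)\<close> the bound on \<open>F\<close> along the ray through \<open>a\<close> gives \<open>\<le>\<close>, and the points
  of the tori \<open>t = R a\<close> where the maximum is attained give \<open>\<ge>\<close>; translating the centre of the
  polydiscs to \<open>x\<close> only changes \<open>R\<close> by a bounded amount.  For \<open>\<sigma>\<^sub>k(u)\<close> the upper bound also uses that
  the recession function does not depend on the base point of the ray.  For the lower bound, the
  same inequality \<open>F(R t) \<le> F(0) + R \<psi>(t)\<close> is applied to every one-variable slice of \<open>u\<close>, viewed as
  a plurisubharmonic function on the whole space, and then maximised over the slices.

  The indicator itself lies in the class \<open>L\<close>, and its maximum over the torus of
  logarithmic radius \<open>t\<close> about \<open>0\<close> is \<open>\<psi>(t)\<close>.  As \<open>\<psi>\<close> is positively homogeneous, it is its own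
  recession function, so the same formulas applied to the indicator at the point \<open>0\<close> give the same
  values.  This is how each pair of equalities is proved.

  Two points need care, since plurisubharmonicity is only given as a submean inequality on complex
  lines.  First, convexity of \<open>F\<close> (\<open>torus_max_segment\<close>) is usually obtained by composing with
  \<open>w \<mapsto> e\<^bsup>t + \<lambda> w\<^esup>\<close>, which is not a line.  It is proved here in the viscosity sense: if \<open>F\<close> exceeded
  a chord, a quadratic function concave along the chord would touch \<open>F\<close> from above, and on a small
  circle of a complex line, whose logarithmic image follows the chord up to second order, the
  submean inequality would fail.  Secondly, the indicator is defined by its values off the
  coordinate hyperplanes.  The extension is the decreasing limit of
  \<open>\<psi>(log (|y\<^sub>1|\<^sup>2 + \<delta>) / 2, \<dots>, log (|y\<^sub>n|\<^sup>2 + \<delta>) / 2)\<close> as \<open>\<delta>\<close> tends to \<open>0\<close>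
  (\<open>plurisubharmonic_reinhardt_ext\<close>), where Jensen's inequality for the convex function \<open>\<psi>\<close> provides
  the submean property; it is unique by upper semicontinuity and the submean property on a line
  transversal to the hyperplanes (\<open>psh_le_of_eq_off_axes\<close>).
\<close>

section \<open>Circle means\<close>

lemma nn_integral_positive_part:
  assumes g: "continuous_on {0..2*pi} g"
  shows "(\<integral>\<^sup>+\<theta>\<in>{0..2*pi}. e2ennreal (ereal (g \<theta>)) \<partial>lborel)
      = ennreal (integral {0..2*pi} (\<lambda>\<theta>. max 0 (g \<theta>)))"
proof -
  have "continuous_on {0..2*pi} (\<lambda>\<theta>. max 0 (g \<theta>))"
    by (intro continuous_intros g)
  then have "((\<lambda>\<theta>. max 0 (g \<theta>)) has_integral integral {0..2*pi} (\<lambda>\<theta>. max 0 (g \<theta>))) {0..2*pi}"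
    using integrable_continuous_interval by blast
  from nn_integral_has_integral_lebesgue[OF _ this]
  have "(\<integral>\<^sup>+\<theta>. ennreal (indicator {0..2*pi} \<theta> * max 0 (g \<theta>)) \<partial>lborel)
    = ennreal (integral {0..2*pi} (\<lambda>\<theta>. max 0 (g \<theta>)))" by auto
  moreover have "(\<integral>\<^sup>+\<theta>. ennreal (indicator {0..2*pi} \<theta> * max 0 (g \<theta>)) \<partial>lborel)
    = (\<integral>\<^sup>+\<theta>\<in>{0..2*pi}. e2ennreal (ereal (g \<theta>)) \<partial>lborel)"
    by (intro nn_integral_cong) (auto simp: indicator_def max_def ennreal_neg e2ennreal_ereal)
  ultimately show ?thesis by simp
qed

lemma integral_via_parts:
  assumes h: "continuous_on {0..2*pi} h"
  shows "(enn2ereal (\<integral>\<^sup>+\<theta>\<in>{0..2*pi}. e2ennreal (ereal (h \<theta>)) \<partial>lborel)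
      - enn2ereal (\<integral>\<^sup>+\<theta>\<in>{0..2*pi}. e2ennreal (- ereal (h \<theta>)) \<partial>lborel))
     = ereal (integral {0..2*pi} h)"
proof -
  have c1: "continuous_on {0..2*pi} (\<lambda>\<theta>. max 0 (h \<theta>))"
    and c2: "continuous_on {0..2*pi} (\<lambda>\<theta>. max 0 (- h \<theta>))"
    by (intro continuous_intros h)+
  have 1: "0 \<le> integral {0..2*pi} (\<lambda>\<theta>. max 0 (h \<theta>))"
    and 2: "0 \<le> integral {0..2*pi} (\<lambda>\<theta>. max 0 (- h \<theta>))"
    using c1 c2 by (auto intro!: integral_nonneg integrable_continuous_interval)
  have "integral {0..2*pi} (\<lambda>\<theta>. max 0 (h \<theta>)) - integral {0..2*pi} (\<lambda>\<theta>. max 0 (- h \<theta>))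
      = integral {0..2*pi} (\<lambda>\<theta>. max 0 (h \<theta>) - max 0 (- h \<theta>))"
    using c1 c2 by (intro integral_diff[symmetric] integrable_continuous_interval)
  also have "(\<lambda>\<theta>. max 0 (h \<theta>) - max 0 (- h \<theta>)) = h" by (auto simp: max_def)
  finally have 3: "integral {0..2*pi} (\<lambda>\<theta>. max 0 (h \<theta>)) - integral {0..2*pi} (\<lambda>\<theta>. max 0 (- h \<theta>))
    = integral {0..2*pi} h" .
  have "continuous_on {0..2*pi} (\<lambda>\<theta>. - h \<theta>)" by (intro continuous_intros h)
  from nn_integral_positive_part[OF h] nn_integral_positive_part[OF this] 1 2 3 show ?thesis by (simp add: enn2ereal_ennreal)
qed

text \<open>
  A pointwise bound by a continuous real function is all that the maximum principle and the
  convexity proof need of the circle mean.  It follows from monotonicity of the two nonnegative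
  integrals.
\<close>

lemma circle_mean_le_integral:
  assumes h: "continuous_on {0..2*pi} h"
    and le: "\<And>\<theta>. v (c + of_real r * cis \<theta>) \<le> ereal (h \<theta>)"
  shows "circle_mean v c r \<le> ereal (integral {0..2*pi} h / (2*pi))"
proof -
  have "circle_mean v c r \<le> ereal (integral {0..2*pi} h) / ereal (2*pi)"
    unfolding circle_mean_def integral_via_parts[OF h, symmetric]
    by (intro ereal_divide_right_mono ereal_minus_mono)
      (auto simp: less_eq_ennreal.rep_eq[symmetric] indicator_def ereal_minus_le_minus 
         simp del: uminus_ereal.simps e2ennreal_ereal
         intro!: nn_integral_mono e2ennreal_mono le)
  then show ?thesis by simp
qed

text \<open>
  The mean value property at \<open>0\<close> of the harmonic function \<open>log |1 + c z|\<close>, which is the real part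
  of a branch of the logarithm holomorphic near the closed unit disc.
\<close>

lemma integral_ln_cmod_one_plus_cis:
  assumes "cmod c < 1"
  shows "((\<lambda>\<theta>. ln (cmod (1 + c * cis \<theta>))) has_integral 0) {0..2*pi}"
proof -
  have nz: "1 + c * z \<notin> \<real>\<^sub>\<le>\<^sub>0" if "cmod z \<le> 1" for z
  proof -
    have "cmod (c * z) < 1" using assms that
      by (metis mult.right_neutral mult_le_cancel_left_pos  norm_ge_zero norm_mult order_le_less_trans mult_left_mono)
    then have "\<bar>Re (c * z)\<bar> < 1" using abs_Re_le_cmod order_le_less_trans by blast
    then show ?thesis by (auto simp: complex_nonpos_Reals_iff)
  qed
  have hol: "(\<lambda>z. Ln (1 + c * z)) holomorphic_on cball 0 1"
    by (intro holomorphic_intros) (use nz in auto)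
  have "((\<lambda>w. Ln (1 + c * w) / (w - 0)) has_contour_integral 2 * of_real pi * \<i> * Ln (1 + c * 0)) (circlepath 0 1)"
    by (rule Cauchy_integral_circlepath)
       (use hol in \<open>auto intro: holomorphic_on_imp_continuous_on holomorphic_on_subset\<close>)
  then have "((\<lambda>w. Ln (1 + c * w) / w) has_contour_integral 0) (circlepath 0 1)" by simp
  moreover have cp: "circlepath 0 1 t = cis (2 * pi * t)" for t
    by (simp add: circlepath cis_conv_exp mult_ac)
  moreover have "vector_derivative (circlepath 0 1) (at t) = 2 * pi * \<i> * cis (2 * pi * t)" for t
    by (simp add: vector_derivative_circlepath cis_conv_exp mult_ac)
  ultimately have "((\<lambda>t. 2 * pi * \<i> * Ln (1 + c * cis (2 * pi * t))) has_integral 0) {0..1}"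
    by (simp add: has_contour_integral mult_ac)
  moreover have "1 + c * cis (2 * pi * t) \<noteq> 0" for t
    using nz[of "cis (2 * pi * t)"] by auto
  note one_plus_ne = this
  ultimately have "((\<lambda>t. Im (2 * pi * \<i> * Ln (1 + c * cis (2 * pi * t)))) has_integral Im 0) {0..1}"
    by (intro has_integral_Im)
  then have "((\<lambda>t. 2 * pi * ln (cmod (1 + c * cis (2 * pi * t)))) has_integral 0) {0..1}"
    by (simp add: Re_Ln[OF one_plus_ne])
  then have "((\<lambda>t. ln (cmod (1 + c * cis (2 * pi * t)))) has_integral 0) {0..1}"
    using has_integral_mult_right[of "\<lambda>t. 2 * pi * ln (cmod (1 + c * cis (2 * pi * t)))" 0 "{0..1}" "1/(2*pi)"]
    by simp
  from has_integral_stretch_real[OF this, of "1 / (2 * pi)"]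
  have "((\<lambda>\<theta>. ln (cmod (1 + c * cis (2 * pi * (1 / (2 * pi) * \<theta>))))) has_integral
      (1 / \<bar>1 / (2 * pi)\<bar>) *\<^sub>R 0) ((\<lambda>t. t / (1 / (2 * pi))) ` {0..1})"
    by simp
  moreover have "(\<lambda>t. t / (1 / (2 * pi))) ` {0..1} = {0..2*pi}"
    using image_mult_atLeastAtMost[of "2*pi" 0 1] by (simp add: mult.commute[of _ "2*pi"])
  moreover have "2 * pi * (1 / (2 * pi) * \<theta>) = \<theta>" for \<theta> by simp
  ultimately show ?thesis by (simp only: scaleR_zero_right)
qed

lemma cos_sin_integrals:
  shows integral_cos: "(cos has_integral 0) {0..2*pi}"
    and integral_sin: "(sin has_integral 0) {0..2*pi}"
    and integral_cos_squared: "((\<lambda>\<theta>. (cos \<theta>)\<^sup>2) has_integral pi) {0..2*pi}"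
proof -
  have "(cos has_integral (sin (2*pi) - sin 0)) {0..2*pi}"
    by (rule fundamental_theorem_of_calculus)
       (auto intro!: derivative_eq_intros simp flip: has_real_derivative_iff_has_vector_derivative)
  then show "(cos has_integral 0) {0..2*pi}" by simp
  have "(sin has_integral (- cos (2*pi) - - cos 0)) {0..2*pi}"
    by (rule fundamental_theorem_of_calculus)
       (auto intro!: derivative_eq_intros simp flip: has_real_derivative_iff_has_vector_derivative)
  then show "(sin has_integral 0) {0..2*pi}" by simp
  have "((\<lambda>\<theta>. (cos \<theta>)\<^sup>2) has_integral ((2*pi + sin (2*pi) * cos (2*pi)) / 2 - (0 + sin 0 * cos 0) / 2)) {0..2*pi}"
  proof (rule fundamental_theorem_of_calculus)
    fix \<theta> :: real
    have "((\<lambda>\<theta>. (\<theta> + sin \<theta> * cos \<theta>) / 2) has_real_derivative (1 + (cos \<theta> * cos \<theta> - sin \<theta> * sin \<theta>)) / 2) (at \<theta> within {0..2*pi})"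
      by (auto intro!: derivative_eq_intros)
    moreover have "(1 + (cos \<theta> * cos \<theta> - sin \<theta> * sin \<theta>)) / 2 = (cos \<theta>)\<^sup>2"
      using sin_cos_squared_add[of \<theta>] by (simp add: power2_eq_square)
    ultimately show "((\<lambda>\<theta>. (\<theta> + sin \<theta> * cos \<theta>) / 2) has_vector_derivative (cos \<theta>)\<^sup>2) (at \<theta> within {0..2*pi})"
      by (simp add: has_real_derivative_iff_has_vector_derivative)
  qed simp
  then show "((\<lambda>\<theta>. (cos \<theta>)\<^sup>2) has_integral pi) {0..2*pi}" by simp
qed

section \<open>Upper semicontinuity and the maximum principle\<close>

lemma upper_semicont_attains_max:
  assumes v: "upper_semicont v" and K: "compact K" "K \<noteq> {}"
  obtains z where "z \<in> K" "\<And>y. y \<in> K \<Longrightarrow> v y \<le> v z"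
proof (rule ccontr)
  assume "\<not> thesis"
  then have "\<forall>z\<in>K. \<exists>y\<in>K. v z < v y" using that by (meson not_le)
  then obtain f where f: "\<And>z. z \<in> K \<Longrightarrow> f z \<in> K" "\<And>z. z \<in> K \<Longrightarrow> v z < v (f z)" by metis
  obtain C where C: "C \<subseteq> K" "finite C" "K \<subseteq> (\<Union>c\<in>C. {w. v w < v (f c)})"
    by (rule compactE_image[OF K(1), of K "\<lambda>c. {w. v w < v (f c)}"])
       (use v f in \<open>auto simp: upper_semicont_def\<close>)
  let ?g = "\<lambda>c. v (f c)"
  have "C \<noteq> {}" using C K by auto
  then have "Max (?g ` C) \<in> ?g ` C" using C(2) by (intro Max_in) auto
  then obtain c where c: "c \<in> C" "?g c = Max (?g ` C)" by auto
  have "f c \<in> K" using c C f by auto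
  then obtain d where d: "d \<in> C" "v (f c) < v (f d)" using C(3) by auto
  moreover have "v (f d) \<le> v (f c)" unfolding c(2) using C(2) d(1) by (intro Max_ge) auto
  ultimately show False by simp
qed

lemma upper_semicont_add_continuous:
  assumes v: "upper_semicont v" and \<phi>: "continuous_on UNIV \<phi>"
  shows "upper_semicont (\<lambda>z. v z + ereal (\<phi> z))"
  unfolding upper_semicont_def
proof
  fix c
  have "{z. v z + ereal (\<phi> z) < c} = (\<Union>q. {z. v z < ereal q} \<inter> {z. ereal (q + \<phi> z) < c})" (is "?L = ?R")
  proof (intro equalityI subsetI)
    fix z assume "z \<in> ?L"
    then have "v z < c - ereal (\<phi> z)" by (auto simp: ereal_less_minus)
    then obtain q where "v z < ereal q" "ereal q < c - ereal (\<phi> z)" using ereal_dense2 by blast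
    then show "z \<in> ?R" by (auto simp: ereal_less_minus)
  next
    fix z assume "z \<in> ?R"
    then obtain q where q: "v z < ereal q" "ereal (q + \<phi> z) < c" by auto
    have "v z + ereal (\<phi> z) \<le> ereal q + ereal (\<phi> z)"
      using q by (intro add_mono) auto
    then show "z \<in> ?L" using q by auto
  qed
  moreover have "open (\<Union>q. {z. v z < ereal q} \<inter> {z. ereal (q + \<phi> z) < c})"
  proof (intro open_UN ballI open_Int)
    show "open {z. v z < ereal q}" for q
      using v by (simp add: upper_semicont_def)
    show "open {z. ereal (q + \<phi> z) < c}" for q
      by (intro open_Collect_less continuous_intros \<phi>)
  qed
  ultimately show "open {z. v z + ereal (\<phi> z) < c}" by (simp only:)
qed

lemma psh_usc: "plurisubharmonic u \<Longrightarrow> upper_semicont u"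
  and psh_less_infinity: "plurisubharmonic u \<Longrightarrow> u z < \<infinity>"
  by (auto simp: plurisubharmonic_def)

lemma psh_le_circle_mean:
  assumes "plurisubharmonic u"
  shows "u a \<le> circle_mean (\<lambda>w. u (a + w *s b)) 0 1"
proof -
  have "subharmonic (\<lambda>w. u (a + w *s b))"
    using assms by (auto simp: plurisubharmonic_def)
  then have "u (a + 0 *s b) \<le> circle_mean (\<lambda>w. u (a + w *s b)) 0 1"
    unfolding subharmonic_def by (metis zero_less_one)
  then show ?thesis by simp
qed

lemma psh_le_integral:
  assumes "plurisubharmonic u" "continuous_on {0..2*pi} h"
    and "\<And>\<theta>. u (a + cis \<theta> *s b) \<le> ereal (h \<theta>)"
  shows "u a \<le> ereal (integral {0..2*pi} h / (2*pi))"
  by (rule order_trans[OF psh_le_circle_mean[OF assms(1)] circle_mean_le_integral[OF assms(2)]])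
     (use assms(3) in simp)

lemma norm_le_sum_cmod: "norm z \<le> (\<Sum>k\<in>UNIV. cmod (z $ k))" for z :: "complex ^ 'n"
  unfolding norm_vec_def by (rule L2_set_le_sum) auto

lemma compact_polydisc:
  fixes x :: "complex ^ 'n"
  shows "compact {z. \<forall>k. cmod (z $ k - x $ k) \<le> \<rho> k}"
proof -
  have "norm z \<le> (\<Sum>k\<in>UNIV. \<rho> k + cmod (x $ k))" if "\<forall>k. cmod (z $ k - x $ k) \<le> \<rho> k" for z :: "complex ^ 'n"
  proof -
    note norm_le_sum_cmod[of z]
    also have "(\<Sum>k\<in>UNIV. cmod (z $ k)) \<le> (\<Sum>k\<in>UNIV. \<rho> k + cmod (x $ k))"
    proof (rule sum_mono)
      fix k show "cmod (z $ k) \<le> \<rho> k + cmod (x $ k)"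
        using that[rule_format, of k] norm_triangle_sub[of "z $ k" "x $ k"] by linarith
    qed
    finally show ?thesis .
  qed
  then have "bounded {z. \<forall>k. cmod (z $ k - x $ k) \<le> \<rho> k}"
    unfolding bounded_iff by blast
  moreover have "closed {z. \<forall>k. cmod (z $ k - x $ k) \<le> \<rho> k}"
    by (intro closed_Collect_all closed_Collect_le continuous_intros)
  ultimately show ?thesis by (simp add: compact_eq_bounded_closed)
qed

text \<open>
  The distinguished boundary already controls the polydisc.  All coordinates are treated at once
  by perturbing \<open>u\<close> to \<open>u + \<epsilon> |z|\<^sup>2\<close>: at a maximum point with a coordinate in the interior of its
  disc, a circle in the direction of that coordinate contradicts the submean inequality.
\<close>

lemma polydisc_maximum_principle:
  fixes u :: "complex ^ 'n \<Rightarrow> ereal"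
  assumes psh: "plurisubharmonic u"
    and M: "\<And>z. (\<And>k. cmod (z $ k - x $ k) = \<rho> k) \<Longrightarrow> u z \<le> M"
    and z: "\<And>k. cmod (z $ k - x $ k) \<le> \<rho> k"
  shows "u z \<le> M"
proof -
  define K where "K = {z. \<forall>k. cmod (z $ k - x $ k) \<le> \<rho> k}"
  have K: "compact K" "z \<in> K" using z by (auto simp: K_def compact_polydisc)
  obtain B where B: "\<And>z. z \<in> K \<Longrightarrow> norm z \<le> B"
    using compact_imp_bounded[OF K(1)] unfolding bounded_iff by auto
  have main: "u z \<le> M + ereal (\<epsilon> * B\<^sup>2)" if "\<epsilon> > 0" for \<epsilon>
  proof -
    have "upper_semicont (\<lambda>z. u z + ereal (\<epsilon> * (norm z)\<^sup>2))"
      by (intro upper_semicont_add_continuous psh_usc psh continuous_intros)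
    then obtain z0 where z0: "z0 \<in> K"
      and max: "\<And>y. y \<in> K \<Longrightarrow> u y + ereal (\<epsilon> * (norm y)\<^sup>2) \<le> u z0 + ereal (\<epsilon> * (norm z0)\<^sup>2)"
      using upper_semicont_attains_max K by (metis (no_types, lifting) empty_iff)
    show ?thesis
    proof (cases "u z0")
      case (real s)
      have "cmod (z0 $ j - x $ j) = \<rho> j" for j
      proof (rule ccontr)
        assume "cmod (z0 $ j - x $ j) \<noteq> \<rho> j"
        define r where "r = \<rho> j - cmod (z0 $ j - x $ j)"
        have r: "r > 0" using z0 \<open>_ \<noteq> _\<close> by (auto simp: K_def r_def less_le)
        define b :: "complex ^ 'n" where "b = axis j (of_real r)"
        define h where "h \<theta> = s - \<epsilon> * r\<^sup>2 - 2 * \<epsilon> * r * (cos \<theta> * Re (z0 $ j) + sin \<theta> * Im (z0 $ j))" for \<theta>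
        have "u (z0 + cis \<theta> *s b) \<le> ereal (h \<theta>)" for \<theta>
        proof -
          let ?y = "z0 + cis \<theta> *s b"
          have "?y \<in> K"
            unfolding K_def
          proof (safe)
            fix k show "cmod (?y $ k - x $ k) \<le> \<rho> k"
            proof (cases "k = j")
              case True
              have "?y $ k - x $ k = (z0 $ j - x $ j) + cis \<theta> * of_real r"
                using True by (simp add: b_def axis_def)
              then have "cmod (?y $ k - x $ k) \<le> cmod (z0 $ j - x $ j) + cmod (cis \<theta> * of_real r)"
                by (simp only: norm_triangle_ineq)
              moreover have "cmod (cis \<theta> * of_real r) = r" using r by (simp add: norm_mult)
              ultimately show ?thesis using True by (simp add: r_def)
            next
              case False
              then show ?thesis using z0 by (auto simp: b_def axis_def K_def)
            qed
          qed
          from max[OF this] have "u ?y + ereal (\<epsilon> * (norm ?y)\<^sup>2) \<le> ereal (s + \<epsilon> * (norm z0)\<^sup>2)"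
            using real by simp
          then have 1: "u ?y \<le> ereal (s + \<epsilon> * (norm z0)\<^sup>2 - \<epsilon> * (norm ?y)\<^sup>2)"
            by (cases "u ?y") auto
          have cb: "cis \<theta> *s b = axis j (cis \<theta> * of_real r)"
            by (auto simp: b_def axis_def vec_eq_iff)
          have n1: "inner (cis \<theta> *s b) (cis \<theta> *s b) = r\<^sup>2"
            using power2_norm_eq_inner[of "cis \<theta> * of_real r"]
            unfolding cb by (simp add: inner_axis_axis norm_mult)
          have n2: "inner z0 (cis \<theta> *s b) = r * (cos \<theta> * Re (z0 $ j) + sin \<theta> * Im (z0 $ j))"
            unfolding cb by (simp add: inner_axis inner_complex_def algebra_simps)
          have "(norm ?y)\<^sup>2 = (norm z0)\<^sup>2 + 2 * inner z0 (cis \<theta> *s b) + inner (cis \<theta> *s b) (cis \<theta> *s b)"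
            by (simp add: power2_norm_eq_inner inner_add inner_commute)
          then have "s + \<epsilon> * (norm z0)\<^sup>2 - \<epsilon> * (norm ?y)\<^sup>2 = h \<theta>"
            unfolding h_def n1 n2 by (simp add: algebra_simps)
          then show ?thesis using 1 by simp
        qed
        then have "u z0 \<le> ereal (integral {0..2*pi} h / (2*pi))"
          by (intro psh_le_integral[OF psh]) (auto simp: h_def intro!: continuous_intros)
        also have "(h has_integral ((2*pi - 0) *\<^sub>R (s - \<epsilon> * r\<^sup>2) - 2 * \<epsilon> * r * (0 * Re (z0 $ j) + 0 * Im (z0 $ j)))) {0..2*pi}"
          unfolding h_def
          by (intro has_integral_diff has_integral_const_real[THEN has_integral_eq_rhs] has_integral_mult_right has_integral_add has_integral_mult_left
              integral_cos integral_sin) auto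
        then have "integral {0..2*pi} h / (2*pi) = s - \<epsilon> * r\<^sup>2"
          by (simp add: integral_unique)
        finally have "s \<le> s - \<epsilon> * r\<^sup>2" using real by simp
        moreover have "0 < \<epsilon> * r\<^sup>2" using that r by simp
        ultimately show False by linarith
      qed
      then have M0: "u z0 \<le> M" by (rule M)
      have "u z \<le> u z + ereal (\<epsilon> * (norm z)\<^sup>2)"
        using that by (cases "u z") auto
      also have "\<dots> \<le> u z0 + ereal (\<epsilon> * (norm z0)\<^sup>2)" by (rule max) fact
      also have "\<dots> \<le> M + ereal (\<epsilon> * B\<^sup>2)"
      proof (rule add_mono[OF M0])
        have "(norm z0)\<^sup>2 \<le> B\<^sup>2" using B[OF z0] by (intro power_mono) auto
        then show "ereal (\<epsilon> * (norm z0)\<^sup>2) \<le> ereal (\<epsilon> * B\<^sup>2)" using that by simp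
      qed
      finally show ?thesis .
    next
      case PInf
      then show ?thesis using psh_less_infinity[OF psh, of z0] by simp
    next
      case MInf
      then show ?thesis using max[OF K(2)] by (cases "u z") auto
    qed
  qed
  show ?thesis
  proof (rule ereal_le_epsilon2)
    fix e :: real assume "e > 0"
    have "u z \<le> M + ereal (e / (B\<^sup>2 + 1) * B\<^sup>2)"
      by (rule main) (use \<open>e > 0\<close> in \<open>auto intro!: divide_pos_pos add_nonneg_pos\<close>)
    also have "e / (B\<^sup>2 + 1) * B\<^sup>2 \<le> e"
      using \<open>e > 0\<close> by (auto simp: pos_divide_le_eq add_nonneg_pos)
    then have "M + ereal (e / (B\<^sup>2 + 1) * B\<^sup>2) \<le> M + ereal e" by (intro add_left_mono) simp
    finally show "u z \<le> M + ereal e" .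
  qed
qed

section \<open>The maximum over tori\<close>

lemma torus_max_attained:
  fixes u :: "complex ^ 'n \<Rightarrow> ereal"
  assumes "plurisubharmonic u"
  obtains z where "\<And>k. cmod (z $ k - x $ k) = exp (t $ k)" "torus_max u x t = u z"
proof -
  let ?T = "{z. \<forall>k. cmod (z $ k - x $ k) = exp (t $ k)}"
  have "closed ?T" by (intro closed_Collect_all closed_Collect_eq continuous_intros)
  then have "compact (?T \<inter> {z. \<forall>k. cmod (z $ k - x $ k) \<le> exp (t $ k)})"
    by (rule closed_Int_compact[OF _ compact_polydisc])
  moreover have "?T \<inter> {z. \<forall>k. cmod (z $ k - x $ k) \<le> exp (t $ k)} = ?T" by auto
  ultimately have "compact ?T" by (simp only:)
  moreover have "(\<chi> k. x $ k + of_real (exp (t $ k))) \<in> ?T" by simp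
  then have "?T \<noteq> {}" by blast
  ultimately obtain z where z: "z \<in> ?T" "\<And>y. y \<in> ?T \<Longrightarrow> u y \<le> u z"
    by (rule upper_semicont_attains_max[OF psh_usc[OF assms]]) blast
  have "torus_max u x t = u z"
    unfolding torus_max_def using z by (intro antisym SUP_least SUP_upper) auto
  with that[of z] z(1) show ?thesis by simp
qed

lemma torus_max_upper: "(\<And>k. cmod (z $ k - x $ k) = exp (t $ k)) \<Longrightarrow> u z \<le> torus_max u x t"
  unfolding torus_max_def by (rule SUP_upper) simp

lemma le_torus_max:
  assumes "plurisubharmonic u" "\<And>k. cmod (z $ k - x $ k) \<le> exp (t $ k)"
  shows "u z \<le> torus_max u x t"
  by (rule polydisc_maximum_principle[OF assms(1) torus_max_upper assms(2)])

lemma torus_max_mono: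
  assumes "plurisubharmonic u" "\<And>k. s $ k \<le> t $ k"
  shows "torus_max u x s \<le> torus_max u x t"
  unfolding torus_max_def[of u x s]
  by (rule SUP_least) (use assms in \<open>auto intro!: le_torus_max\<close>)

lemma torus_max_less_infinity:
  assumes "plurisubharmonic u"
  shows "torus_max u x t < \<infinity>"
  using torus_max_attained[OF assms, of x t] psh_less_infinity[OF assms] by metis

text \<open>
  With polar coordinates on the torus, the superlevel sets of the maximum are projections of
  closed sets along the compact cube of angles.
\<close>

lemma upper_semicont_torus_max:
  fixes u :: "complex ^ 'n \<Rightarrow> ereal"
  assumes "plurisubharmonic u"
  shows "upper_semicont (torus_max u x)"
  unfolding upper_semicont_def
proof
  fix c
  let ?P = "\<lambda>(\<theta>::real^'n, t::real^'n). (\<chi> k. x $ k + of_real (exp (t $ k)) * cis (\<theta> $ k)) :: complex ^ 'n"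
  let ?T = "?P -` {z. c \<le> u z}"
  have cont: "continuous_on UNIV ?P"
    unfolding case_prod_unfold by (intro continuous_intros)
  have "{z. c \<le> u z} = - {z. u z < c}" by auto
  then have "closed {z. c \<le> u z}"
    using psh_usc[OF assms] by (simp add: upper_semicont_def closed_Compl)
  then have "closed ?T" by (rule closed_vimage[OF _ cont])
  then have "closed {t. \<exists>\<theta>. \<theta> \<in> cbox 0 (\<chi> k. 2*pi) \<and> (\<theta>, t) \<in> ?T}"
    by (intro closed_compact_projection compact_cbox)
  also have "{t. \<exists>\<theta>. \<theta> \<in> cbox 0 (\<chi> k. 2*pi) \<and> (\<theta>, t) \<in> ?T} = - {t. torus_max u x t < c}" (is "?L = ?R")
  proof (intro equalityI subsetI)
    fix t assume "t \<in> ?L"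
    then obtain \<theta> where "c \<le> u (?P (\<theta>, t))" by auto
    also have "\<dots> \<le> torus_max u x t" by (rule torus_max_upper) (simp add: norm_mult)
    finally show "t \<in> ?R" by auto
  next
    fix t assume t: "t \<in> ?R"
    obtain z where z: "\<And>k. cmod (z $ k - x $ k) = exp (t $ k)" "torus_max u x t = u z"
      using torus_max_attained[OF assms] by metis
    define \<theta> :: "real ^ 'n" where "\<theta> = (\<chi> k. Arg2pi (z $ k - x $ k))"
    have "?P (\<theta>, t) = z"
    proof -
      have "x $ k + of_real (exp (t $ k)) * cis (\<theta> $ k) = z $ k" for k
        using Arg2pi_eq[of "z $ k - x $ k"] unfolding z \<theta>_def by (simp add: cis_conv_exp)
      then show ?thesis by (simp add: vec_eq_iff)
    qed
    moreover have "\<theta> \<in> cbox 0 (\<chi> k. 2*pi)"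
      by (auto simp: \<theta>_def mem_box_cart Arg2pi_ge_0 less_imp_le[OF Arg2pi_lt_2pi])
    ultimately show "t \<in> ?L" using t z by (intro CollectI exI[of _ \<theta>]) auto
  qed
  finally show "open {t. torus_max u x t < c}" by (simp add: open_closed)
qed

text \<open>
  A circle on the complex line through \<open>z\<close> with direction \<open>(v\<^sub>k (z\<^sub>k - x\<^sub>k))\<^sub>k\<close>, seen in the
  logarithmic coordinates \<open>log |z\<^sub>k - x\<^sub>k|\<close>, is a translate of this closed curve.
\<close>

definition log_circle :: "real ^ 'n \<Rightarrow> real \<Rightarrow> real ^ 'n" where
  "log_circle v \<theta> = (\<chi> k. ln (cmod (1 + of_real (v $ k) * cis \<theta>)))"

lemma one_plus_cis_nonzero: "\<bar>r\<bar> < 1 \<Longrightarrow> 1 + of_real r * cis \<theta> \<noteq> 0"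
  by (metis add_eq_0_iff norm_cis norm_minus_cancel norm_mult norm_of_real norm_one mult.right_neutral less_irrefl)

text \<open>
  The submean inequality on complex lines in logarithmic coordinates.  The shape of the curve does
  not depend on the point of the torus, so the supremum over the torus can be taken.
\<close>

lemma torus_max_le_integral:
  fixes u :: "complex ^ 'n \<Rightarrow> ereal"
  assumes "plurisubharmonic u" and v: "\<And>k. \<bar>v $ k\<bar> < 1"
    and h: "continuous_on {0..2*pi} h" "\<And>\<theta>. torus_max u x (t + log_circle v \<theta>) \<le> ereal (h \<theta>)"
  shows "torus_max u x t \<le> ereal (integral {0..2*pi} h / (2*pi))"
  unfolding torus_max_def[of u x t]
proof (rule SUP_least)
  fix z assume "z \<in> {z. \<forall>k. cmod (z $ k - x $ k) = exp (t $ k)}"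
  then have z: "cmod (z $ k - x $ k) = exp (t $ k)" for k by simp
  define b :: "complex ^ 'n" where "b = (\<chi> k. of_real (v $ k) * (z $ k - x $ k))"
  show "u z \<le> ereal (integral {0..2*pi} h / (2*pi))"
  proof (rule psh_le_integral[OF assms(1) h(1), where b = b])
    fix \<theta>
    have "u (z + cis \<theta> *s b) \<le> torus_max u x (t + log_circle v \<theta>)"
    proof (rule torus_max_upper)
      fix k
      have "(z + cis \<theta> *s b) $ k - x $ k = (z $ k - x $ k) * (1 + of_real (v $ k) * cis \<theta>)"
        by (simp add: b_def algebra_simps)
      then show "cmod ((z + cis \<theta> *s b) $ k - x $ k) = exp ((t + log_circle v \<theta>) $ k)"
        using one_plus_cis_nonzero[OF v[of k], of \<theta>] z[of k]
        by (simp add: norm_mult log_circle_def exp_add)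
    qed
    then show "u (z + cis \<theta> *s b) \<le> ereal (h \<theta>)" using h(2) order_trans by blast
  qed
qed

lemma inner_log_circle_has_integral:
  fixes v :: "real ^ 'n"
  assumes "\<And>k. \<bar>v $ k\<bar> < 1"
  shows "((\<lambda>\<theta>. g \<bullet> log_circle v \<theta>) has_integral 0) {0..2*pi}"
proof -
  have "((\<lambda>\<theta>. \<Sum>k\<in>UNIV. g $ k * ln (cmod (1 + of_real (v $ k) * cis \<theta>))) has_integral (\<Sum>k\<in>(UNIV::'n set). g $ k * 0)) {0..2*pi}"
    by (intro has_integral_sum has_integral_mult_right integral_ln_cmod_one_plus_cis) (use assms in auto)
  then show ?thesis by (simp add: inner_vec_def log_circle_def)
qed

text \<open>
  To first order the logarithmic image of a circle is the real segment in direction \<open>v\<close>, run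
  through as \<open>cos \<theta>\<close>.
\<close>

lemma log_circle_approx:
  fixes v :: "real ^ 'n"
  assumes "0 < r" "r * norm v \<le> 1/2"
  shows "norm (log_circle (r *\<^sub>R v) \<theta> - (r * cos \<theta>) *\<^sub>R v) \<le> 2 * CARD('n) * (norm v)\<^sup>2 * r\<^sup>2"
proof -
  have comp: "\<bar>(log_circle (r *\<^sub>R v) \<theta> - (r * cos \<theta>) *\<^sub>R v) $ k\<bar> \<le> 2 * (norm v)\<^sup>2 * r\<^sup>2" for k
  proof -
    define z where "z = of_real (r * v $ k) * cis \<theta>"
    have nz: "cmod z = r * \<bar>v $ k\<bar>" using assms by (simp add: z_def norm_mult abs_mult)
    also have "\<dots> \<le> r * norm v" using assms component_le_norm_cart[of v k] by (intro mult_left_mono) auto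
    finally have z: "cmod z \<le> r * norm v" "cmod z \<le> 1/2" using assms by auto
    have "1 + z \<noteq> 0"
    proof
      assume "1 + z = 0"
      then have "z = - 1" by (simp add: add_eq_0_iff)
      then show False using z(2) by simp
    qed
    have "\<bar>Re (Ln (1 + z) - z)\<bar> \<le> cmod (Ln (1 + z) - z)" by (rule abs_Re_le_cmod)
    also have "\<dots> \<le> (cmod z)\<^sup>2 / (1 - cmod z)" using Ln_approx_linear[of z] z by simp
    also have "\<dots> \<le> (cmod z)\<^sup>2 / (1/2)" using z by (intro divide_left_mono) auto
    also have "\<dots> \<le> 2 * (r * norm v)\<^sup>2" using z by (auto intro!: power_mono)
    finally have "\<bar>ln (cmod (1 + z)) - Re z\<bar> \<le> 2 * (norm v)\<^sup>2 * r\<^sup>2"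
      using \<open>1 + z \<noteq> 0\<close> by (simp add: power_mult_distrib mult_ac)
    then show ?thesis by (simp add: log_circle_def z_def mult_ac)
  qed
  have "norm (log_circle (r *\<^sub>R v) \<theta> - (r * cos \<theta>) *\<^sub>R v) \<le> (\<Sum>k\<in>(UNIV::'n set). \<bar>(log_circle (r *\<^sub>R v) \<theta> - (r * cos \<theta>) *\<^sub>R v) $ k\<bar>)"
    by (rule norm_le_l1_cart)
  also have "\<dots> \<le> (\<Sum>k\<in>(UNIV::'n set). 2 * (norm v)\<^sup>2 * r\<^sup>2)" by (intro sum_mono comp)
  finally show ?thesis by (simp add: mult_ac)
qed

text \<open>
  The convexity inequality for the torus maximum \<open>F\<close>, with strict upper bounds \<open>A\<close> and \<open>B\<close> at the
  end points in place of the values, which are not yet known to be finite.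

  Coordinates \<open>s\<close> (along the segment) and \<open>w\<close> (orthogonal to it) are used on a thin tube around the
  segment.  If the inequality fails, then the barrier
  \<open>\<phi> = A + s (B - A) + K |w|\<^sup>2 + \<epsilon> s (1 - s)\<close> lies below \<open>F\<close> somewhere on the segment but not on
  the boundary of the tube, so \<open>F - \<phi>\<close> has an interior maximum.  There \<open>F\<close> is bounded by \<open>\<phi>\<close> plus
  a constant, and the submean inequality on a small logarithmic circle in the direction of the
  segment gives a contradiction: the linear part of \<open>\<phi>\<close> has mean zero, \<open>- \<epsilon> s\<^sup>2\<close> contributes
  \<open>- \<epsilon> r\<^sup>2 / 2\<close>, and the penalty \<open>K |w|\<^sup>2\<close> is only of order \<open>r\<^sup>4\<close>.
\<close>

lemma torus_max_segment:
  fixes u :: "complex ^ 'n \<Rightarrow> ereal" and p q :: "real ^ 'n"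
  assumes psh: "plurisubharmonic u"
    and A: "torus_max u x p < ereal A" and B: "torus_max u x q < ereal B"
    and \<tau>: "0 < \<tau>" "\<tau> < 1"
  shows "torus_max u x (p + \<tau> *\<^sub>R (q - p)) \<le> ereal (A + \<tau> * (B - A))"
proof (cases "q = p")
  case True
  have "min A B \<le> A + \<tau> * (B - A)"
  proof (cases "A \<le> B")
    case True then show ?thesis using \<tau> by simp
  next
    case False
    then have "\<tau> * (A - B) \<le> 1 * (A - B)" using \<tau> by (intro mult_right_mono) auto
    then show ?thesis using False by (simp add: algebra_simps)
  qed
  moreover have "torus_max u x p \<le> ereal (min A B)" using A B True by (simp add: min_def less_imp_le)
  ultimately have "torus_max u x p \<le> ereal (A + \<tau> * (B - A))"
    by (metis ereal_less_eq(3) order_trans)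
  then show ?thesis using True by simp
next
  case False
  define F where "F = torus_max u x"
  define v where "v = q - p"
  define N where "N = v \<bullet> v"
  define s where "s t = ((t - p) \<bullet> v) / N" for t
  define w where "w t = t - p - s t *\<^sub>R v" for t
  have N: "N > 0" "N = (norm v)\<^sup>2" "v \<noteq> 0" using False by (auto simp: N_def v_def power2_norm_eq_inner)
  have wv: "w t \<bullet> v = 0" for t
    using N by (simp add: w_def s_def N_def inner_diff_left)
  have cont: "continuous_on S s" "continuous_on S w" for S
    unfolding w_def s_def by (intro continuous_intros, use N in simp)+
  have usc: "upper_semicont F" unfolding F_def by (rule upper_semicont_torus_max[OF psh])
  show ?thesis
  proof (rule ccontr)
    define m where "m = p + \<tau> *\<^sub>R v"
    have sm: "s m = \<tau>" "w m = 0" using N by (auto simp: s_def m_def w_def N_def)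
    assume "\<not> ?thesis"
    then have "ereal (A + \<tau> * (B - A)) < F m" by (simp add: F_def m_def v_def)
    then obtain y where y: "A + \<tau> * (B - A) < y" "ereal y < F m"
      by (metis ereal_dense2 ereal_less_eq(3) less_ereal.simps(1))
    define \<epsilon> where "\<epsilon> = (y - (A + \<tau> * (B - A))) / (\<tau> * (1 - \<tau>))"
    have \<epsilon>: "\<epsilon> > 0" "A + \<tau> * (B - A) + \<epsilon> * (\<tau> * (1 - \<tau>)) = y"
      using y \<tau> by (auto simp: \<epsilon>_def)
    obtain d1 where d1: "d1 > 0" "\<And>t. dist p t < d1 \<Longrightarrow> F t < ereal A"
      using usc A unfolding upper_semicont_def F_def open_contains_ball
      by (metis (mono_tags, lifting) mem_Collect_eq mem_ball subsetD)
    obtain d2 where d2: "d2 > 0" "\<And>t. dist q t < d2 \<Longrightarrow> F t < ereal B"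
      using usc B unfolding upper_semicont_def F_def open_contains_ball
      by (metis (mono_tags, lifting) mem_Collect_eq mem_ball subsetD)
    \<comment> \<open>The tube is so thin that its end faces lie where \<open>F\<close> is below \<open>A\<close>, respectively \<open>B\<close>.\<close>
    define \<delta> where "\<delta> = min d1 d2 / 2"
    have \<delta>: "0 < \<delta>" "\<delta> < d1" "\<delta> < d2" using d1 d2 by (auto simp: \<delta>_def)
    define D where "D = {t. 0 \<le> s t \<and> s t \<le> 1 \<and> norm (w t) \<le> \<delta>}"
    have "m \<in> D" using sm \<tau> \<delta> by (auto simp: D_def)
    have "compact D"
    proof -
      have "norm t \<le> norm p + norm v + \<delta>" if "t \<in> D" for t
      proof -
        have "norm t = norm (p + s t *\<^sub>R v + w t)" by (simp add: w_def)
        also have "\<dots> \<le> norm p + norm (s t *\<^sub>R v) + norm (w t)"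
          by (intro order_trans[OF norm_triangle_ineq] add_right_mono norm_triangle_ineq)
        also have "norm (s t *\<^sub>R v) \<le> 1 * norm v"
          unfolding norm_scaleR using that by (intro mult_right_mono) (auto simp: D_def)
        finally show ?thesis using that by (simp add: D_def)
      qed
      then have "bounded D" unfolding bounded_iff by blast
      moreover have "closed D"
        unfolding D_def by (intro closed_Collect_conj closed_Collect_le continuous_intros cont)
      ultimately show ?thesis by (simp add: compact_eq_bounded_closed)
    qed
    obtain M where M: "M \<ge> 0" "\<And>t. t \<in> D \<Longrightarrow> F t \<le> ereal M"
    proof -
      obtain z where z: "z \<in> D" "\<And>t. t \<in> D \<Longrightarrow> F t \<le> F z"
        using upper_semicont_attains_max[OF usc \<open>compact D\<close>] \<open>m \<in> D\<close> by blast
      have "F z < \<infinity>" unfolding F_def by (rule torus_max_less_infinity[OF psh])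
      then have "F z \<le> ereal (max 0 (real_of_ereal (F z)))" by (cases "F z") auto
      then show ?thesis using that z by (meson max.cobounded1 order_trans)
    qed
    \<comment> \<open>\<open>K\<close> lifts the barrier above the bound \<open>M\<close> of \<open>F\<close> on the lateral boundary of the tube.\<close>
    define K where "K = (M + \<bar>A\<bar> + \<bar>B\<bar>) / \<delta>\<^sup>2"
    have K: "K \<ge> 0" "K * \<delta>\<^sup>2 = M + \<bar>A\<bar> + \<bar>B\<bar>" using M \<delta> by (auto simp: K_def)
    define \<phi> where "\<phi> t = A + s t * (B - A) + K * (norm (w t))\<^sup>2 + \<epsilon> * (s t * (1 - s t))" for t
    have \<phi>_cont: "continuous_on UNIV \<phi>" unfolding \<phi>_def by (intro continuous_intros cont)
    have "upper_semicont (\<lambda>t. F t + ereal (- \<phi> t))"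
      by (intro upper_semicont_add_continuous usc continuous_intros \<phi>_cont)
    then obtain t0 where t0: "t0 \<in> D"
      and max: "\<And>t. t \<in> D \<Longrightarrow> F t + ereal (- \<phi> t) \<le> F t0 + ereal (- \<phi> t0)"
      using upper_semicont_attains_max[OF _ \<open>compact D\<close>] \<open>m \<in> D\<close> by blast
    have "\<phi> m = y" using sm \<epsilon> by (simp add: \<phi>_def)
    then have "0 < F m + ereal (- \<phi> m)" using y by (cases "F m") auto
    then have pos: "0 < F t0 + ereal (- \<phi> t0)" using max[OF \<open>m \<in> D\<close>] by (rule less_le_trans)
    have "F t0 < \<infinity>" unfolding F_def by (rule torus_max_less_infinity[OF psh])
    with pos obtain f0 where f0: "F t0 = ereal f0" "\<phi> t0 < f0" by (cases "F t0") auto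
    have Ds: "0 \<le> s t0" "s t0 \<le> 1" "norm (w t0) \<le> \<delta>" using t0 by (auto simp: D_def)
    have lin: "- \<bar>A\<bar> - \<bar>B\<bar> \<le> A + s t0 * (B - A)"
    proof -
      have "A + s t0 * (B - A) = (1 - s t0) * A + s t0 * B" by (simp add: algebra_simps)
      moreover have "\<bar>(1 - s t0) * A\<bar> \<le> 1 * \<bar>A\<bar>" "\<bar>s t0 * B\<bar> \<le> 1 * \<bar>B\<bar>"
        unfolding abs_mult using Ds by (intro mult_right_mono; simp)+
      ultimately show ?thesis by linarith
    qed
    have "s t0 \<noteq> 0"
    proof
      assume 0: "s t0 = 0"
      then have "t0 = p + w t0" by (simp add: w_def)
      then have "dist p t0 = norm (w t0)" by (metis dist_add_cancel2 dist_commute add.commute dist_0_norm add_0)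
      then have "F t0 < ereal A" using Ds \<delta> d1 by simp
      moreover have "A \<le> \<phi> t0" using 0 K by (simp add: \<phi>_def)
      ultimately show False using f0 by simp
    qed
    have "s t0 \<noteq> 1"
    proof
      assume 1: "s t0 = 1"
      then have "t0 - q = w t0" by (simp add: w_def v_def)
      then have "dist q t0 = norm (w t0)" by (metis dist_norm dist_commute)
      then have "F t0 < ereal B" using Ds \<delta> d2 by simp
      moreover have "B \<le> \<phi> t0" using 1 K by (simp add: \<phi>_def)
      ultimately show False using f0 by simp
    qed
    have "norm (w t0) \<noteq> \<delta>"
    proof
      assume "norm (w t0) = \<delta>"
      then have "\<phi> t0 = A + s t0 * (B - A) + (M + \<bar>A\<bar> + \<bar>B\<bar>) + \<epsilon> * (s t0 * (1 - s t0))"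
        using K by (simp add: \<phi>_def)
      moreover have "0 \<le> \<epsilon> * (s t0 * (1 - s t0))" using Ds \<epsilon> by simp
      ultimately have "M \<le> \<phi> t0" using lin by linarith
      then show False using f0 M(2)[OF t0] by simp
    qed
    define U where "U = {t. 0 < s t \<and> s t < 1 \<and> norm (w t) < \<delta>}"
    have "open U" unfolding U_def by (intro open_Collect_conj open_Collect_less continuous_intros cont)
    moreover have "t0 \<in> U"
      using Ds \<open>s t0 \<noteq> 0\<close> \<open>s t0 \<noteq> 1\<close> \<open>norm (w t0) \<noteq> \<delta>\<close> by (auto simp: U_def)
    ultimately obtain e where e: "e > 0" "ball t0 e \<subseteq> U" unfolding open_contains_ball by blast
    have "U \<subseteq> D" by (auto simp: U_def D_def)
    define C where "C = 2 * CARD('n) * (norm v)\<^sup>2"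
    have "C \<ge> 0" by (simp add: C_def)
    have "\<exists>r>0. r * norm v < 1/2 \<and> r * norm v + C * r\<^sup>2 < e \<and> K * C\<^sup>2 * r\<^sup>2 + 2 * \<epsilon> * (C / norm v) * r < \<epsilon> / 2"
    proof -
      have 1: "((\<lambda>r. r * norm v) \<longlongrightarrow> 0 * norm v) (at_right 0)"
        and 2: "((\<lambda>r. r * norm v + C * r\<^sup>2) \<longlongrightarrow> 0 * norm v + C * 0\<^sup>2) (at_right 0)"
        and 3: "((\<lambda>r. K * C\<^sup>2 * r\<^sup>2 + 2 * \<epsilon> * (C / norm v) * r) \<longlongrightarrow> K * C\<^sup>2 * 0\<^sup>2 + 2 * \<epsilon> * (C / norm v) * 0) (at_right 0)"
        by (intro tendsto_intros)+
      have "\<forall>\<^sub>F r in at_right 0. r * norm v < 1/2"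
        by (rule order_tendstoD(2)[OF 1]) simp
      moreover have "\<forall>\<^sub>F r in at_right 0. r * norm v + C * r\<^sup>2 < e"
        by (rule order_tendstoD(2)[OF 2]) (use e in simp)
      moreover have "\<forall>\<^sub>F r in at_right 0. K * C\<^sup>2 * r\<^sup>2 + 2 * \<epsilon> * (C / norm v) * r < \<epsilon> / 2"
        by (rule order_tendstoD(2)[OF 3]) (use \<epsilon> in simp)
      moreover have "\<forall>\<^sub>F r::real in at_right 0. 0 < r" by (rule eventually_at_right_less)
      ultimately have "\<forall>\<^sub>F r in at_right 0. 0 < r \<and> r * norm v < 1/2 \<and> r * norm v + C * r\<^sup>2 < e \<and> K * C\<^sup>2 * r\<^sup>2 + 2 * \<epsilon> * (C / norm v) * r < \<epsilon> / 2"
        by eventually_elim auto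
      then show ?thesis by (metis (mono_tags, lifting) eventually_happens trivial_limit_at_right_real)
    qed
    then obtain r where r: "r > 0" "r * norm v < 1/2" "r * norm v + C * r\<^sup>2 < e"
      "K * C\<^sup>2 * r\<^sup>2 + 2 * \<epsilon> * (C / norm v) * r < \<epsilon> / 2" by blast
    have rv: "\<bar>(r *\<^sub>R v) $ k\<bar> < 1" for k
    proof -
      have "\<bar>(r *\<^sub>R v) $ k\<bar> \<le> norm (r *\<^sub>R v)" by (rule component_le_norm_cart)
      also have "\<dots> < 1" using r by simp
      finally show ?thesis .
    qed
    \<comment> \<open>The gradient of \<open>\<phi>\<close> at the maximum point \<open>t0\<close>.\<close>
    define g where "g = ((B - A + \<epsilon> * (1 - 2 * s t0)) / N) *\<^sub>R v + (2 * K) *\<^sub>R w t0"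
    \<comment> \<open>The two corrections bound the penalty \<open>K |w|\<^sup>2\<close> and the error in \<open>s = r cos \<theta> + O(r\<^sup>2)\<close>.\<close>
    define c where "c = f0 + K * C\<^sup>2 * r^4 + 2 * \<epsilon> * (C / norm v) * r^3"
    define h where "h \<theta> = c + g \<bullet> log_circle (r *\<^sub>R v) \<theta> - \<epsilon> * r\<^sup>2 * (cos \<theta>)\<^sup>2" for \<theta>
    have Fh: "F (t0 + log_circle (r *\<^sub>R v) \<theta>) \<le> ereal (h \<theta>)" for \<theta>
    proof -
      define V where "V = log_circle (r *\<^sub>R v) \<theta>"
      define E where "E = V - (r * cos \<theta>) *\<^sub>R v"
      have E: "norm E \<le> C * r\<^sup>2"
        unfolding E_def V_def C_def using r by (intro log_circle_approx) auto
      have VE: "V = (r * cos \<theta>) *\<^sub>R v + E" by (simp add: E_def)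
      have "norm V \<le> norm ((r * cos \<theta>) *\<^sub>R v) + norm E" unfolding VE by (rule norm_triangle_ineq)
      also have "norm ((r * cos \<theta>) *\<^sub>R v) \<le> r * norm v"
        using r by (simp add: abs_mult mult_right_mono mult_left_le)
      finally have "norm V < e" using E r(3) by linarith
      then have "t0 + V \<in> ball t0 e" by (simp add: dist_norm)
      then have "t0 + V \<in> D" using e \<open>U \<subseteq> D\<close> by blast
      from max[OF this] have 1: "F (t0 + V) \<le> ereal (f0 + (\<phi> (t0 + V) - \<phi> t0))"
        using f0 by (cases "F (t0 + V)") auto
      define \<sigma> where "\<sigma> = (V \<bullet> v) / N"
      define \<rho> where "\<rho> = V - \<sigma> *\<^sub>R v"
      have s': "s (t0 + V) = s t0 + \<sigma>"
        by (simp add: s_def \<sigma>_def inner_add_left inner_diff_left add_divide_distrib diff_divide_distrib)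
      have w': "w (t0 + V) = w t0 + \<rho>" unfolding w_def \<rho>_def s' by (simp add: algebra_simps)
      define \<eta> where "\<eta> = (E \<bullet> v) / N"
      have \<sigma>: "\<sigma> = r * cos \<theta> + \<eta>"
        using N by (simp add: \<sigma>_def \<eta>_def VE inner_add_left N_def add_divide_distrib)
      have \<rho>: "\<rho> = E - \<eta> *\<^sub>R v" unfolding \<rho>_def \<sigma> VE by (simp add: algebra_simps)
      have \<eta>b: "\<bar>\<eta>\<bar> \<le> C / norm v * r\<^sup>2"
      proof -
        have "\<bar>E \<bullet> v\<bar> \<le> norm E * norm v" by (rule Cauchy_Schwarz_ineq2)
        also have "\<dots> \<le> C * r\<^sup>2 * norm v" using E by (intro mult_right_mono) auto
        finally have "\<bar>\<eta>\<bar> \<le> C * r\<^sup>2 * norm v / N" using N by (simp add: \<eta>_def divide_right_mono)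
        then show ?thesis using N by (simp add: power2_eq_square field_simps)
      qed
      have \<rho>b: "(norm \<rho>)\<^sup>2 \<le> C\<^sup>2 * r^4"
      proof -
        have "(norm \<rho>)\<^sup>2 = E \<bullet> E - 2 * \<eta> * (E \<bullet> v) + \<eta>\<^sup>2 * N"
          unfolding \<rho> power2_norm_eq_inner
          by (simp add: inner_diff_left inner_diff_right inner_commute N_def power2_eq_square algebra_simps)
        also have "E \<bullet> v = \<eta> * N" using N by (simp add: \<eta>_def)
        finally have "(norm \<rho>)\<^sup>2 = (norm E)\<^sup>2 - \<eta>\<^sup>2 * N"
          unfolding power2_norm_eq_inner[of E] by (simp add: power2_eq_square algebra_simps)
        then have "(norm \<rho>)\<^sup>2 \<le> (norm E)\<^sup>2" using N by simp
        also have "\<dots> \<le> (C * r\<^sup>2)\<^sup>2" using E by (intro power_mono) auto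
        finally show ?thesis by (simp add: power_mult_distrib flip: power_mult)
      qed
      have \<sigma>b: "r\<^sup>2 * (cos \<theta>)\<^sup>2 - 2 * (C / norm v) * r^3 \<le> \<sigma>\<^sup>2"
      proof -
        have "\<bar>r * cos \<theta> * \<eta>\<bar> \<le> r * (C / norm v * r\<^sup>2)"
        proof -
          have "\<bar>r * cos \<theta>\<bar> \<le> r" using r by (simp add: abs_mult mult_left_le)
          then show ?thesis unfolding abs_mult[of "r * cos \<theta>"] using \<eta>b r by (intro mult_mono) auto
        qed
        then have "- (r * (C / norm v * r\<^sup>2)) \<le> r * cos \<theta> * \<eta>" by linarith
        moreover have "\<sigma>\<^sup>2 = r\<^sup>2 * (cos \<theta>)\<^sup>2 + 2 * (r * cos \<theta> * \<eta>) + \<eta>\<^sup>2"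
          unfolding \<sigma> by (simp add: power2_eq_square algebra_simps)
        moreover have "r * (C / norm v * r\<^sup>2) = C / norm v * r^3" by (simp add: power2_eq_square power3_eq_cube)
        moreover have "0 \<le> \<eta>\<^sup>2" by simp
        ultimately show ?thesis by linarith
      qed
      have gV: "g \<bullet> V = \<sigma> * (B - A) + 2 * K * (w t0 \<bullet> \<rho>) + \<epsilon> * (\<sigma> * (1 - 2 * s t0))"
      proof -
        have "v \<bullet> V = \<sigma> * N" using N by (simp add: \<sigma>_def inner_commute)
        then have "(B - A + \<epsilon> * (1 - 2 * s t0)) / N * (v \<bullet> V) = (B - A + \<epsilon> * (1 - 2 * s t0)) * \<sigma>"
          using N(1) by simp
        moreover have "w t0 \<bullet> \<rho> = w t0 \<bullet> V" using wv[of t0] by (simp add: \<rho>_def inner_diff_right)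
        ultimately show ?thesis
          unfolding g_def inner_add_left inner_scaleR_left by (simp add: algebra_simps)
      qed
      have "(norm (w t0 + \<rho>))\<^sup>2 = (norm (w t0))\<^sup>2 + 2 * (w t0 \<bullet> \<rho>) + (norm \<rho>)\<^sup>2"
        by (simp add: power2_norm_eq_inner inner_add_left inner_add_right inner_commute)
      then have "\<phi> (t0 + V) - \<phi> t0 = g \<bullet> V + K * (norm \<rho>)\<^sup>2 - \<epsilon> * \<sigma>\<^sup>2"
        unfolding \<phi>_def s' w' gV by (simp add: algebra_simps power2_eq_square)
      also have "\<dots> \<le> g \<bullet> V + K * (C\<^sup>2 * r^4) - \<epsilon> * (r\<^sup>2 * (cos \<theta>)\<^sup>2 - 2 * (C / norm v) * r^3)"
        using \<rho>b \<sigma>b K \<epsilon> by (intro diff_mono add_left_mono mult_left_mono) auto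
      finally have "f0 + (\<phi> (t0 + V) - \<phi> t0) \<le> h \<theta>"
        by (simp add: h_def c_def V_def algebra_simps)
      then show ?thesis using 1 unfolding V_def by (meson ereal_less_eq(3) order_trans)
    qed
    have h_int: "(h has_integral (2*pi*c + 0 - \<epsilon> * r\<^sup>2 * pi)) {0..2*pi}"
      unfolding h_def
      by (intro has_integral_diff has_integral_add has_integral_mult_right integral_cos_squared
            inner_log_circle_has_integral rv)
         (use has_integral_const_real[of c 0 "2*pi"] in simp)
    have "continuous_on {0..2*pi} h"
      unfolding h_def log_circle_def
      by (intro continuous_intros) (use one_plus_cis_nonzero[OF rv] in auto)
    from torus_max_le_integral[OF psh rv this, of x t0] Fh
    have "F t0 \<le> ereal (integral {0..2*pi} h / (2*pi))" by (simp add: F_def)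
    also have "integral {0..2*pi} h / (2*pi) = c - \<epsilon> * r\<^sup>2 / 2"
      using h_int by (simp add: integral_unique field_simps)
    finally have "f0 \<le> c - \<epsilon> * r\<^sup>2 / 2" using f0 by simp
    moreover have "c - \<epsilon> * r\<^sup>2 / 2 = f0 + r\<^sup>2 * (K * C\<^sup>2 * r\<^sup>2 + 2 * \<epsilon> * (C / norm v) * r - \<epsilon> / 2)"
      by (simp add: c_def algebra_simps power2_eq_square power3_eq_cube power4_eq_xxxx)
    moreover have "r\<^sup>2 * (K * C\<^sup>2 * r\<^sup>2 + 2 * \<epsilon> * (C / norm v) * r - \<epsilon> / 2) < 0"
      using r by (intro mult_pos_neg) auto
    ultimately show False by linarith
  qed
qed

section \<open>Convexity in logarithmic coordinates and the recession function\<close>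

definition log_max :: "(complex ^ 'n \<Rightarrow> ereal) \<Rightarrow> complex ^ 'n \<Rightarrow> real ^ 'n \<Rightarrow> real" where
  "log_max u x t = real_of_ereal (torus_max u x t)"

text \<open>
  The maximum is finite.  It is at least \<open>u z0\<close> on every torus enclosing a point \<open>z0\<close> with
  \<open>u z0 \<noteq> -\<infinity>\<close>; and if it were \<open>-\<infinity>\<close> at some \<open>t\<close>, then by convexity also at the midpoint \<open>T\<close> of a
  segment starting in \<open>t\<close>, hence on such large tori.
\<close>

lemma torus_max_eq_log_max:
  fixes u :: "complex ^ 'n \<Rightarrow> ereal"
  assumes psh: "plurisubharmonic u"
  shows "torus_max u x t = ereal (log_max u x t)"
proof -
  obtain z0 where z0: "u z0 \<noteq> -\<infinity>" using psh by (auto simp: plurisubharmonic_def)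
  define T :: "real ^ 'n" where "T = (\<chi> k. ln (cmod (z0 $ k - x $ k) + 1))"
  have "cmod (z0 $ k - x $ k) \<le> exp (T $ k)" for k
    by (simp add: T_def add_nonneg_pos)
  then have "u z0 \<le> torus_max u x T" by (rule le_torus_max[OF psh])
  then have T: "torus_max u x T \<noteq> -\<infinity>" using z0 by auto
  define q where "q = 2 *\<^sub>R T - t"
  have fin: "torus_max u x s < \<infinity>" for s by (rule torus_max_less_infinity[OF psh])
  obtain B where B: "torus_max u x q < ereal B"
    using fin[of q] by (metis ereal_dense2)
  have "torus_max u x t \<noteq> -\<infinity>"
  proof
    assume "torus_max u x t = -\<infinity>"
    then have lt: "torus_max u x t < ereal A" for A by simp
    have "torus_max u x T \<le> ereal c" for c
    proof -
      have "t + (1/2) *\<^sub>R (q - t) = T" by (simp add: q_def vec_eq_iff field_simps)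
      moreover have "torus_max u x (t + (1/2) *\<^sub>R (q - t)) \<le> ereal ((2 * c - B) + 1/2 * (B - (2 * c - B)))"
        by (rule torus_max_segment[OF psh lt B]) auto
      moreover have "(2 * c - B) + 1/2 * (B - (2 * c - B)) = c" by (simp add: field_simps)
      ultimately show ?thesis by (simp only:)
    qed
    then have "torus_max u x T = -\<infinity>" by (rule ereal_bot)
    then show False using T by simp
  qed
  then show ?thesis using fin[of t] by (cases "torus_max u x t") (auto simp: log_max_def)
qed

lemma log_max_convex:
  assumes psh: "plurisubharmonic u"
  shows "convex_on UNIV (log_max u x)"
proof (rule convex_onI)
  fix \<tau> :: real and p q assume \<tau>: "0 < \<tau>" "\<tau> < 1"
  note eq = torus_max_eq_log_max[OF psh, of x]
  show "log_max u x ((1 - \<tau>) *\<^sub>R p + \<tau> *\<^sub>R q) \<le> (1 - \<tau>) * log_max u x p + \<tau> * log_max u x q"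
  proof (rule field_le_epsilon)
    fix e :: real assume "e > 0"
    then have "torus_max u x p < ereal (log_max u x p + e)" "torus_max u x q < ereal (log_max u x q + e)"
      by (simp_all add: eq)
    from torus_max_segment[OF psh this \<tau>]
    show "log_max u x ((1 - \<tau>) *\<^sub>R p + \<tau> *\<^sub>R q) \<le> (1 - \<tau>) * log_max u x p + \<tau> * log_max u x q + e"
      by (simp add: eq algebra_simps)
  qed
qed simp

lemma log_max_mono:
  assumes "plurisubharmonic u" "\<And>k. s $ k \<le> t $ k"
  shows "log_max u x s \<le> log_max u x t"
  using torus_max_mono[OF assms(1), of s t x] assms by (simp add: torus_max_eq_log_max)

lemma le_log_max:
  assumes "plurisubharmonic u" "\<And>k. cmod (z $ k - x $ k) \<le> exp (t $ k)"
  shows "u z \<le> ereal (log_max u x t)"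
  using le_torus_max[OF assms] by (simp add: torus_max_eq_log_max[OF assms(1)])

lemma log_max_attained:
  fixes u :: "complex ^ 'n \<Rightarrow> ereal"
  assumes "plurisubharmonic u"
  obtains z where "\<And>k. cmod (z $ k - x $ k) = exp (t $ k)" "u z = ereal (log_max u x t)"
  using torus_max_attained[OF assms, of x t] torus_max_eq_log_max[OF assms, of x t] that by metis

lemma log_max_linear_bound:
  fixes u :: "complex ^ 'n \<Rightarrow> ereal"
  assumes "u \<in> Lclass"
  shows "\<exists>C. \<forall>R\<ge>1. log_max u x (R *\<^sub>R t) \<le> C * R"
proof -
  have psh: "plurisubharmonic u" using assms by (simp add: Lclass_def)
  obtain C1 C2 where C: "C1 \<ge> 0" "C2 \<ge> 0" "\<And>z. u z \<le> ereal (C1 * max 0 (ln (norm z)) + C2)"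
    using assms unfolding Lclass_def by blast
  define b where "b = norm x + CARD('n)"
  have b: "b \<ge> 1" by (simp add: b_def add_increasing)
  have "log_max u x (R *\<^sub>R t) \<le> (C1 * (ln b + norm t) + C2) * R" if "R \<ge> 1" for R
  proof -
    obtain z where z: "\<And>k. cmod (z $ k - x $ k) = exp ((R *\<^sub>R t) $ k)" "u z = ereal (log_max u x (R *\<^sub>R t))"
      using log_max_attained[OF psh] by metis
    have "norm (z - x) \<le> (\<Sum>k\<in>UNIV. cmod ((z - x) $ k))"
      by (rule norm_le_sum_cmod)
    also have "\<dots> \<le> (\<Sum>k\<in>(UNIV::'n set). exp (R * norm t))"
    proof (rule sum_mono)
      fix k
      have "R * t $ k \<le> R * norm t"
        using that component_le_norm_cart[of t k] by (intro mult_left_mono) auto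
      then show "norm ((z - x) $ k) \<le> exp (R * norm t)" using z(1)[of k] by simp
    qed
    finally have "norm (z - x) \<le> CARD('n) * exp (R * norm t)" by simp
    moreover have "norm x \<le> norm x * exp (R * norm t)" using that by (simp add: mult_le_cancel_left1)
    moreover have "norm z \<le> norm x + norm (z - x)" by (metis add.commute diff_add_cancel norm_triangle_ineq)
    ultimately have nz: "norm z \<le> b * exp (R * norm t)" by (simp add: b_def algebra_simps)
    then have "max 0 (ln (norm z)) \<le> ln b + R * norm t"
    proof (cases "norm z = 0")
      case False
      then have "ln (norm z) \<le> ln (b * exp (R * norm t))"
        using nz by (intro ln_mono) (auto simp del: ln_mult)
      also have "\<dots> = ln b + R * norm t" using b by (simp add: ln_mult)
      finally show ?thesis using b that by simp
    qed (use b that in simp)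
    then have "C1 * max 0 (ln (norm z)) + C2 \<le> C1 * (ln b + R * norm t) + C2"
      using C by (intro add_right_mono mult_left_mono) auto
    also have "\<dots> \<le> (C1 * (ln b + norm t) + C2) * R"
    proof -
      have "C1 * ln b * 1 \<le> C1 * ln b * R" "C2 * 1 \<le> C2 * R"
        using that C b by (intro mult_left_mono; simp)+
      then show ?thesis by (simp add: algebra_simps)
    qed
    finally show ?thesis using C(3)[of z] z(2) by simp
  qed
  then show ?thesis by blast
qed

lemma const_over_tendsto_0: "((\<lambda>R::real. c / R) \<longlongrightarrow> 0) at_top" for c :: real
  by (rule tendsto_divide_0[OF tendsto_const filterlim_at_top_imp_at_infinity[OF filterlim_ident]])

text \<open>
  The slopes \<open>(f(R t) - f(0)) / R\<close> increase with \<open>R\<close>, so they converge to their supremum, which is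
  finite by the linear bound.
\<close>

lemma convex_recession:
  fixes f :: "'a::real_vector \<Rightarrow> real"
  assumes f: "convex_on UNIV f" and C: "\<And>R. R \<ge> 1 \<Longrightarrow> f (R *\<^sub>R t) \<le> C * R"
  obtains g where "((\<lambda>R. f (R *\<^sub>R t) / R) \<longlongrightarrow> g) at_top" "\<And>R. R \<ge> 0 \<Longrightarrow> f (R *\<^sub>R t) \<le> f 0 + R * g"
proof -
  \<comment> \<open>The slope of the chord from \<open>0\<close> to \<open>R t\<close>.\<close>
  define m where "m R = (f (R *\<^sub>R t) - f 0) / R" for R
  have mono: "m R \<le> m S" if "0 < R" "R \<le> S" for R S
  proof -
    have "f ((1 - R / S) *\<^sub>R 0 + (R / S) *\<^sub>R (S *\<^sub>R t)) \<le> (1 - R / S) * f 0 + (R / S) * f (S *\<^sub>R t)"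
      using that by (intro convex_onD[OF f]) auto
    then have "f (R *\<^sub>R t) - f 0 \<le> R * m S"
      using that by (simp add: m_def field_simps)
    then show ?thesis using that by (simp add: m_def field_simps)
  qed
  define g where "g = (SUP R\<in>{1..}. m R)"
  have "m R \<le> C + \<bar>f 0\<bar>" if "R \<ge> 1" for R
  proof -
    have "\<bar>f 0\<bar> * 1 \<le> \<bar>f 0\<bar> * R" using that by (intro mult_left_mono) auto
    then have "f (R *\<^sub>R t) - f 0 \<le> (C + \<bar>f 0\<bar>) * R" using C[OF that] by (simp add: algebra_simps)
    then show ?thesis using that by (simp add: m_def field_simps)
  qed
  then have bdd: "bdd_above (m ` {1..})" by (intro bdd_aboveI) auto
  have le_g: "m R \<le> g" if "R > 0" for R
  proof -
    have "m R \<le> m (max 1 R)" using that by (intro mono) auto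
    also have "\<dots> \<le> g" unfolding g_def by (intro cSUP_upper bdd) auto
    finally show ?thesis .
  qed
  have "(m \<longlongrightarrow> g) at_top"
  proof (rule order_tendstoI)
    fix a assume "a < g"
    then obtain R0 where R0: "R0 \<ge> 1" "a < m R0"
      unfolding g_def by (subst (asm) less_cSUP_iff) (use bdd in auto)
    show "\<forall>\<^sub>F R in at_top. a < m R"
      using eventually_ge_at_top[of R0]
      by eventually_elim (use R0 mono[of R0] in \<open>auto intro: less_le_trans\<close>)
  next
    fix a assume "g < a"
    then show "\<forall>\<^sub>F R in at_top. m R < a"
      using le_less_trans[OF le_g] by (auto intro: eventually_mono[OF eventually_gt_at_top[of 0]])
  qed
  moreover have "((\<lambda>R. f 0 / R) \<longlongrightarrow> 0) at_top" by (rule const_over_tendsto_0)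
  ultimately have "((\<lambda>R. m R + f 0 / R) \<longlongrightarrow> g + 0) at_top" by (rule tendsto_add)
  then have "((\<lambda>R. f (R *\<^sub>R t) / R) \<longlongrightarrow> g) at_top"
    by (simp add: m_def diff_divide_distrib)
  moreover have "f (R *\<^sub>R t) \<le> f 0 + R * g" if "R \<ge> 0" for R
    using le_g[of R] that by (cases "R = 0") (auto simp: m_def field_simps)
  ultimately show thesis using that by blast
qed

definition psi_real :: "(complex ^ 'n \<Rightarrow> ereal) \<Rightarrow> complex ^ 'n \<Rightarrow> real ^ 'n \<Rightarrow> real" where
  "psi_real u x t = real_of_ereal (psi u x t)"

lemma psi_eqI:
  assumes psh: "plurisubharmonic u" and "((\<lambda>R. log_max u x (R *\<^sub>R t) / R) \<longlongrightarrow> g) at_top"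
  shows "psi u x t = ereal g"
proof -
  have "((\<lambda>R. ereal (log_max u x (R *\<^sub>R t) / R)) \<longlongrightarrow> ereal g) at_top"
    using assms(2) by simp
  moreover have "\<forall>\<^sub>F R in at_top. torus_max u x (R *\<^sub>R t) / ereal R = ereal (log_max u x (R *\<^sub>R t) / R)"
    using eventually_gt_at_top[of "0::real"]
    by eventually_elim (simp add: torus_max_eq_log_max[OF psh])
  ultimately have "((\<lambda>R. torus_max u x (R *\<^sub>R t) / ereal R) \<longlongrightarrow> ereal g) at_top"
    by (simp add: tendsto_cong)
  then show ?thesis unfolding psi_def by (intro tendsto_Lim) auto
qed

text \<open>
  The last part is the quantitative form of the limit that is used throughout; it holds for all
  \<open>R \<ge> 0\<close> since the slopes increase to \<open>\<psi>\<close>.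
\<close>

lemma psi_props:
  assumes "u \<in> Lclass"
  shows psi_eq_psi_real: "psi u x t = ereal (psi_real u x t)"
    and log_max_tendsto: "((\<lambda>R. log_max u x (R *\<^sub>R t) / R) \<longlongrightarrow> psi_real u x t) at_top"
    and log_max_ray_le: "R \<ge> 0 \<Longrightarrow> log_max u x (R *\<^sub>R t) \<le> log_max u x 0 + R * psi_real u x t"
proof -
  have psh: "plurisubharmonic u" using assms by (simp add: Lclass_def)
  obtain C where C: "\<And>R. R \<ge> 1 \<Longrightarrow> log_max u x (R *\<^sub>R t) \<le> C * R"
    using log_max_linear_bound[OF assms] by blast
  obtain g where g: "((\<lambda>R. log_max u x (R *\<^sub>R t) / R) \<longlongrightarrow> g) at_top"
    "\<And>R. R \<ge> 0 \<Longrightarrow> log_max u x (R *\<^sub>R t) \<le> log_max u x 0 + R * g"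
    using convex_recession[OF log_max_convex[OF psh] C] by blast
  from psi_eqI[OF psh g(1)] have "psi u x t = ereal g" .
  then have "psi_real u x t = g" by (simp add: psi_real_def)
  then show "psi u x t = ereal (psi_real u x t)"
    "((\<lambda>R. log_max u x (R *\<^sub>R t) / R) \<longlongrightarrow> psi_real u x t) at_top"
    "R \<ge> 0 \<Longrightarrow> log_max u x (R *\<^sub>R t) \<le> log_max u x 0 + R * psi_real u x t"
    using g \<open>psi u x t = ereal g\<close> by auto
qed

lemma psi_convex:
  assumes "u \<in> Lclass"
  shows "convex_on UNIV (psi_real u x)"
proof (rule convex_onI)
  have psh: "plurisubharmonic u" using assms by (simp add: Lclass_def)
  fix \<tau> :: real and p q assume \<tau>: "0 < \<tau>" "\<tau> < 1"
  let ?f = "log_max u x"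
  have "((\<lambda>R. (1 - \<tau>) * (?f (R *\<^sub>R p) / R) + \<tau> * (?f (R *\<^sub>R q) / R)) \<longlongrightarrow>
      (1 - \<tau>) * psi_real u x p + \<tau> * psi_real u x q) at_top"
    by (intro tendsto_intros log_max_tendsto assms)
  moreover have "\<forall>\<^sub>F R in at_top. ?f (R *\<^sub>R ((1 - \<tau>) *\<^sub>R p + \<tau> *\<^sub>R q)) / R
     \<le> (1 - \<tau>) * (?f (R *\<^sub>R p) / R) + \<tau> * (?f (R *\<^sub>R q) / R)"
    using eventually_gt_at_top[of 0]
  proof eventually_elim
    case (elim R)
    have "R *\<^sub>R ((1 - \<tau>) *\<^sub>R p + \<tau> *\<^sub>R q) = (1 - \<tau>) *\<^sub>R (R *\<^sub>R p) + \<tau> *\<^sub>R (R *\<^sub>R q)"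
      by (simp add: algebra_simps)
    then have "?f (R *\<^sub>R ((1 - \<tau>) *\<^sub>R p + \<tau> *\<^sub>R q)) \<le> (1 - \<tau>) * ?f (R *\<^sub>R p) + \<tau> * ?f (R *\<^sub>R q)"
      using convex_onD[OF log_max_convex[OF psh], of \<tau> "R *\<^sub>R p" "R *\<^sub>R q" x] \<tau> by simp
    then show ?case using elim by (simp add: divide_right_mono add_divide_distrib[symmetric])
  qed
  ultimately show "psi_real u x ((1 - \<tau>) *\<^sub>R p + \<tau> *\<^sub>R q) \<le> (1 - \<tau>) * psi_real u x p + \<tau> * psi_real u x q"
    using log_max_tendsto[OF assms] by (intro tendsto_le[OF trivial_limit_at_top_linorder])
qed simp

lemma psi_mono:
  assumes "u \<in> Lclass" "\<And>k. s $ k \<le> t $ k"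
  shows "psi_real u x s \<le> psi_real u x t"
proof -
  have psh: "plurisubharmonic u" using assms by (simp add: Lclass_def)
  have "\<forall>\<^sub>F R in at_top. log_max u x (R *\<^sub>R s) / R \<le> log_max u x (R *\<^sub>R t) / R"
    using eventually_gt_at_top[of 0]
    by eventually_elim (auto intro!: divide_right_mono log_max_mono psh mult_left_mono assms)
  then show ?thesis
    using log_max_tendsto[OF assms(1)] by (intro tendsto_le[OF trivial_limit_at_top_linorder])
qed

lemma psi_scaleR:
  assumes "u \<in> Lclass" "c \<ge> 0"
  shows "psi_real u x (c *\<^sub>R t) = c * psi_real u x t"
proof (cases "c = 0")
  case True
  have "((\<lambda>R. log_max u x 0 / R) \<longlongrightarrow> 0) at_top" by (rule const_over_tendsto_0)
  then have "psi_real u x 0 = 0"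
    using log_max_tendsto[OF assms(1), of x 0] by (auto intro: tendsto_unique[OF trivial_limit_at_top_linorder])
  then show ?thesis using True by simp
next
  case False
  then have c: "c > 0" using assms by simp
  have "filterlim (\<lambda>R. c * R) at_top at_top"
    by (rule filterlim_tendsto_pos_mult_at_top[OF tendsto_const c filterlim_ident])
  from filterlim_compose[OF log_max_tendsto[OF assms(1)] this]
  have "((\<lambda>R. c * (log_max u x ((c * R) *\<^sub>R t) / (c * R))) \<longlongrightarrow> c * psi_real u x t) at_top"
    by (rule tendsto_mult_left)
  then have "((\<lambda>R. log_max u x (R *\<^sub>R (c *\<^sub>R t)) / R) \<longlongrightarrow> c * psi_real u x t) at_top"
    using c by (simp add: mult.commute)
  then show ?thesis
    using log_max_tendsto[OF assms(1)] by (intro tendsto_unique[OF trivial_limit_at_top_linorder])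
qed

section \<open>Growth along weights\<close>

lemma le_Limsup_along:
  fixes f :: "'a \<Rightarrow> ereal"
  assumes y: "filterlim y F G" and G: "G \<noteq> bot" and l: "((\<lambda>R. f (y R)) \<longlongrightarrow> l) G"
  shows "l \<le> Limsup F f"
proof (rule dense_ge)
  fix c assume "Limsup F f < c"
  then have "\<forall>\<^sub>F z in F. f z < c" by (rule Limsup_lessD)
  then have "\<forall>\<^sub>F R in G. f (y R) < c" using y by (rule eventually_compose_filterlim)
  then have "\<forall>\<^sub>F R in G. f (y R) \<le> c" by eventually_elim simp
  then show "l \<le> c" using l G by (intro tendsto_upperbound)
qed

lemma ratio_tendsto:
  fixes f n :: "real \<Rightarrow> real"
  assumes f: "((\<lambda>R. f R / R) \<longlongrightarrow> \<beta>) at_top" and n: "\<forall>\<^sub>F R in at_top. \<bar>n R - R\<bar> \<le> C"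
  shows "((\<lambda>R. f R / n R) \<longlongrightarrow> \<beta>) at_top"
proof -
  have "\<forall>\<^sub>F R in at_top. norm ((n R - R) / R) \<le> C / R"
    using n eventually_gt_at_top[of 0] by eventually_elim (simp add: divide_right_mono)
  then have "((\<lambda>R. (n R - R) / R) \<longlongrightarrow> 0) at_top"
    using const_over_tendsto_0 by (rule Lim_null_comparison)
  then have "((\<lambda>R. (f R / R) / (1 + (n R - R) / R)) \<longlongrightarrow> \<beta> / (1 + 0)) at_top"
    by (intro tendsto_intros f) auto
  moreover have "\<forall>\<^sub>F R in at_top. (f R / R) / (1 + (n R - R) / R) = f R / n R"
    using eventually_gt_at_top[of 0] by eventually_elim (simp add: field_simps)
  ultimately have "((\<lambda>R. f R / n R) \<longlongrightarrow> \<beta> / (1 + 0)) at_top" by (rule Lim_transform_eventually)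
  then show ?thesis by simp
qed

text \<open>
  The growth of \<open>u\<close> relative to any gauge \<open>N\<close> that agrees with \<open>max\<^sub>k log |z\<^sub>k| / a\<^sub>k\<close> up to a bounded
  error.  The gauges \<open>log |z|\<close> and \<open>S\<^sub>a\<close> are both of this form.  The constant \<open>c\<close> absorbs
  that error, and the constant \<open>d\<close> of the proof absorbs the shift of the centre from \<open>0\<close> to \<open>x\<close>.
\<close>

lemma growth_eq_psi:
  fixes u :: "complex ^ 'n \<Rightarrow> ereal" and a :: "real ^ 'n" and N :: "complex ^ 'n \<Rightarrow> real"
  assumes u: "u \<in> Lclass" and a: "\<And>k. a $ k > 0"
    and up: "\<forall>\<^sub>F z in at_infinity. \<forall>k. cmod (z $ k) \<le> exp (a $ k * (N z + c))"
    and lo: "\<forall>\<^sub>F z in at_infinity. \<exists>k. exp (a $ k * (N z - c)) \<le> cmod (z $ k)"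
  shows "Limsup at_infinity (\<lambda>z. u z / ereal (N z)) = psi u x a"
proof -
  have psh: "plurisubharmonic u" using u by (simp add: Lclass_def)
  define \<beta> where "\<beta> = psi_real u x a"
  define d where "d = (\<Sum>k\<in>UNIV. ln (1 + cmod (x $ k)) / a $ k)"
  have absorb: "exp (a $ k * s) + cmod (x $ k) \<le> exp (a $ k * (s + d))" if "s \<ge> 0" for k s
  proof -
    have "ln (1 + cmod (x $ k)) / a $ k \<le> d"
      unfolding d_def using a by (intro member_le_sum) (auto intro!: divide_nonneg_pos)
    then have "ln (1 + cmod (x $ k)) \<le> a $ k * d" using a[of k] by (simp add: field_simps)
    then have "exp (ln (1 + cmod (x $ k))) \<le> exp (a $ k * d)" by simp
    then have 1: "1 + cmod (x $ k) \<le> exp (a $ k * d)" by (simp add: add_pos_nonneg)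
    have "1 \<le> exp (a $ k * s)" using that a[of k] by simp
    then have "cmod (x $ k) * 1 \<le> cmod (x $ k) * exp (a $ k * s)" by (intro mult_left_mono) auto
    then have "exp (a $ k * s) + cmod (x $ k) \<le> exp (a $ k * s) * (1 + cmod (x $ k))"
      by (simp add: algebra_simps)
    also have "\<dots> \<le> exp (a $ k * s) * exp (a $ k * d)" using 1 by (intro mult_left_mono) auto
    finally show ?thesis by (simp add: algebra_simps exp_add)
  qed
  have N: "filterlim N at_top at_infinity"
    unfolding filterlim_at_top
  proof
    fix Z
    define B where "B = (\<Sum>k\<in>UNIV. exp (a $ k * (Z + c)))"
    have "\<forall>\<^sub>F z in at_infinity. B + 1 \<le> norm (z :: complex ^ 'n)"
      unfolding eventually_at_infinity by blast
    with up show "\<forall>\<^sub>F z in at_infinity. Z \<le> N z"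
    proof eventually_elim
      case (elim z)
      show ?case
      proof (rule ccontr)
        assume "\<not> Z \<le> N z"
        then have "cmod (z $ k) \<le> exp (a $ k * (Z + c))" for k
          using elim(1)[rule_format, of k] a[of k]
          by (meson add_right_mono exp_le_cancel_iff less_imp_le linorder_not_le mult_left_mono order_trans)
        then have "(\<Sum>k\<in>UNIV. cmod (z $ k)) \<le> B" unfolding B_def by (intro sum_mono)
        then show False using elim(2) norm_le_sum_cmod[of z] by linarith
      qed
    qed
  qed
  have "Limsup at_infinity (\<lambda>z. u z / ereal (N z)) \<le> ereal \<beta>"
  proof -
    define r where "r z = (log_max u x 0 + (c + d) * \<beta>) / N z + \<beta>" for z
    have "\<forall>\<^sub>F z in at_infinity. N z \<ge> 1" "\<forall>\<^sub>F z in at_infinity. N z \<ge> - c"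
      using N by (auto simp: filterlim_at_top)
    with up have "\<forall>\<^sub>F z in at_infinity. u z / ereal (N z) \<le> ereal (r z)"
    proof eventually_elim
      case (elim z)
      have "d \<ge> 0" unfolding d_def using a by (intro sum_nonneg) (auto intro!: divide_nonneg_pos)
      have "cmod (z $ k - x $ k) \<le> exp (((N z + c + d) *\<^sub>R a) $ k)" for k
      proof -
        have "cmod (z $ k - x $ k) \<le> cmod (z $ k) + cmod (x $ k)" by (rule norm_triangle_ineq4)
        also have "\<dots> \<le> exp (a $ k * (N z + c)) + cmod (x $ k)" using elim(1) by simp
        also have "\<dots> \<le> exp (a $ k * (N z + c + d))" using elim by (intro absorb) simp
        finally show ?thesis by (simp add: mult.commute)
      qed
      then have "u z \<le> ereal (log_max u x ((N z + c + d) *\<^sub>R a))" by (rule le_log_max[OF psh])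
      also have "\<dots> \<le> ereal (log_max u x 0 + (N z + c + d) * \<beta>)"
        using log_max_ray_le[OF u, of "N z + c + d" x a] elim \<open>d \<ge> 0\<close> by (simp add: \<beta>_def)
      finally have "u z / ereal (N z) \<le> ereal (log_max u x 0 + (N z + c + d) * \<beta>) / ereal (N z)"
        using elim by (intro ereal_divide_right_mono) auto
      also have "\<dots> = ereal (r z)" using elim by (simp add: r_def field_simps)
      finally show ?case .
    qed
    then have "Limsup at_infinity (\<lambda>z. u z / ereal (N z)) \<le> Limsup at_infinity (\<lambda>z. ereal (r z))"
      by (rule Limsup_mono)
    also have "(r \<longlongrightarrow> 0 + \<beta>) at_infinity"
      unfolding r_def by (intro tendsto_add tendsto_const filterlim_compose[OF const_over_tendsto_0 N])
    then have "((\<lambda>z. ereal (r z)) \<longlongrightarrow> ereal \<beta>) at_infinity" by simp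
    then have "Limsup at_infinity (\<lambda>z. ereal (r z)) = ereal \<beta>"
      by (intro lim_imp_Limsup trivial_limit_at_infinity)
    finally show ?thesis .
  qed
  moreover have "ereal \<beta> \<le> Limsup at_infinity (\<lambda>z. u z / ereal (N z))"
  proof -
    have "\<forall>R. \<exists>z. (\<forall>k. cmod (z $ k - x $ k) = exp ((R *\<^sub>R a) $ k)) \<and> u z = ereal (log_max u x (R *\<^sub>R a))"
      using log_max_attained[OF psh] by metis
    then obtain y where y: "\<And>R k. cmod (y R $ k - x $ k) = exp ((R *\<^sub>R a) $ k)"
        "\<And>R. u (y R) = ereal (log_max u x (R *\<^sub>R a))"
      by metis
    have le1: "cmod (y R $ k) \<le> exp (a $ k * R) + cmod (x $ k)" for R k
      using y(1)[of R k] norm_triangle_ineq[of "y R $ k - x $ k" "x $ k"] by (simp add: mult.commute)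
    have ge1: "exp (a $ k * R) \<le> cmod (y R $ k) + cmod (x $ k)" for R k
      using y(1)[of R k] norm_triangle_ineq4[of "y R $ k" "x $ k"] by (simp add: mult.commute)
    have y_inf: "filterlim y at_infinity at_top"
    proof (rule filterlim_norm_at_top_imp_at_infinity, rule filterlim_at_top_mono)
      fix k :: 'n
      show "filterlim (\<lambda>R. - cmod (x $ k) + exp (a $ k * R)) at_top at_top"
        by (rule filterlim_tendsto_add_at_top[OF tendsto_const filterlim_compose[OF exp_at_top
              filterlim_tendsto_pos_mult_at_top[OF tendsto_const a filterlim_ident]]])
      show "\<forall>\<^sub>F R in at_top. - cmod (x $ k) + exp (a $ k * R) \<le> norm (y R)"
      proof (rule always_eventually, rule)
        fix R
        have "cmod (y R $ k) \<le> norm (y R)" by (rule Finite_Cartesian_Product.norm_nth_le)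
        then show "- cmod (x $ k) + exp (a $ k * R) \<le> norm (y R)" using ge1[of k R] by linarith
      qed
    qed
    have "\<forall>\<^sub>F R in at_top. \<bar>N (y R) - R\<bar> \<le> \<bar>c\<bar> + d"
    proof -
      have "\<forall>\<^sub>F z in at_infinity. N z \<ge> - c" using N by (auto simp: filterlim_at_top)
      with up lo have "\<forall>\<^sub>F z in at_infinity. (\<forall>k. cmod (z $ k) \<le> exp (a $ k * (N z + c))) \<and>
          (\<exists>k. exp (a $ k * (N z - c)) \<le> cmod (z $ k)) \<and> N z \<ge> - c"
        by eventually_elim auto
      then have "\<forall>\<^sub>F R in at_top. (\<forall>k. cmod (y R $ k) \<le> exp (a $ k * (N (y R) + c))) \<and>
          (\<exists>k. exp (a $ k * (N (y R) - c)) \<le> cmod (y R $ k)) \<and> N (y R) \<ge> - c"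
        using y_inf by (rule eventually_compose_filterlim)
      then show ?thesis using eventually_ge_at_top[of 0]
      proof eventually_elim
        case (elim R)
        fix l :: 'n
        have "exp (a $ l * R) \<le> exp (a $ l * (N (y R) + c)) + cmod (x $ l)"
          using ge1[where R = R and k = l] elim by (meson add_right_mono order_trans)
        also have "\<dots> \<le> exp (a $ l * (N (y R) + c + d))" using elim by (intro absorb) simp
        finally have 1: "R \<le> N (y R) + c + d" using a[of l] by simp
        obtain k where "exp (a $ k * (N (y R) - c)) \<le> cmod (y R $ k)" using elim by blast
        also have "\<dots> \<le> exp (a $ k * R) + cmod (x $ k)" by (rule le1)
        also have "\<dots> \<le> exp (a $ k * (R + d))" using elim by (intro absorb) simp
        finally have "N (y R) - c \<le> R + d" using a[of k] by simp
        with 1 show ?case by linarith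
      qed
    qed
    from ratio_tendsto[OF log_max_tendsto[OF u, of x a] this]
    have "((\<lambda>R. ereal (log_max u x (R *\<^sub>R a) / N (y R))) \<longlongrightarrow> ereal \<beta>) at_top"
      by (simp add: \<beta>_def)
    moreover have "\<forall>\<^sub>F R in at_top. N (y R) \<ge> 1"
      using filterlim_compose[OF N y_inf] by (auto simp: filterlim_at_top)
    then have "\<forall>\<^sub>F R in at_top. u (y R) / ereal (N (y R)) = ereal (log_max u x (R *\<^sub>R a) / N (y R))"
      by eventually_elim (simp add: y(2))
    ultimately have "((\<lambda>R. u (y R) / ereal (N (y R))) \<longlongrightarrow> ereal \<beta>) at_top"
      by (simp add: tendsto_cong)
    then show ?thesis by (intro le_Limsup_along[OF y_inf]) auto
  qed
  ultimately show ?thesis by (simp add: psi_eq_psi_real[OF u] \<beta>_def)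
qed

text \<open>
  The Euclidean norm lies between the maximum norm and \<open>n\<close> times the maximum norm, so \<open>log |z|\<close> is
  a gauge for the weights \<open>1\<close> with error \<open>log n\<close>.
\<close>

lemma log_type_eq_psi:
  fixes u :: "complex ^ 'n \<Rightarrow> ereal"
  assumes u: "u \<in> Lclass"
  shows "log_type u = psi u x 1"
  unfolding log_type_def
proof (rule growth_eq_psi[OF u, where c = "ln CARD('n)"])
  have ge1: "\<forall>\<^sub>F z in at_infinity. 1 \<le> norm (z :: complex ^ 'n)"
    unfolding eventually_at_infinity by blast
  show "\<forall>\<^sub>F z in at_infinity. \<forall>k. cmod (z $ k) \<le> exp (1 $ k * (ln (norm (z :: complex ^ 'n)) + ln CARD('n)))"
    using ge1
  proof (eventually_elim, intro allI)
    fix z :: "complex ^ 'n" and k assume z: "1 \<le> norm z"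
    have "cmod (z $ k) \<le> norm z * 1" using Finite_Cartesian_Product.norm_nth_le[of z k] by simp
    also have "\<dots> \<le> norm z * CARD('n)" by (intro mult_left_mono) (auto simp: Suc_le_eq)
    also have "\<dots> = exp (ln (norm z) + ln CARD('n))" using z by (subst exp_add, subst (1 2) exp_ln) auto
    finally show "cmod (z $ k) \<le> exp (1 $ k * (ln (norm z) + ln CARD('n)))" by simp
  qed
  show "\<forall>\<^sub>F z in at_infinity. \<exists>k. exp (1 $ k * (ln (norm (z :: complex ^ 'n)) - ln CARD('n))) \<le> cmod (z $ k)"
    using ge1
  proof eventually_elim
    case z: (elim z)
    show ?case
    proof (rule ccontr)
    assume "\<not> (\<exists>k. exp (1 $ k * (ln (norm z) - ln CARD('n))) \<le> cmod (z $ k))"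
    moreover have "exp (ln (norm z) - ln CARD('n)) = norm z / CARD('n)"
      using z by (subst exp_diff, subst (1 2) exp_ln) auto
    ultimately have "cmod (z $ k) < norm z / CARD('n)" for k by (auto simp: not_le)
    then have "(\<Sum>k\<in>UNIV. cmod (z $ k)) < (\<Sum>k\<in>(UNIV::'n set). norm z / CARD('n))"
      by (intro sum_strict_mono) auto
    then show False using norm_le_sum_cmod[of z] by simp
    qed
  qed
qed simp

lemma dir_lelong_eq_psi:
  fixes u :: "complex ^ 'n \<Rightarrow> ereal"
  assumes u: "u \<in> Lclass" and a: "\<And>k. a $ k > 0"
  shows "dir_lelong u a = psi u x a"
proof -
  have S: "\<exists>r. S_dir a z = ereal r \<and> (\<forall>k. cmod (z $ k) \<le> exp (a $ k * r)) \<and> (\<exists>k. exp (a $ k * r) \<le> cmod (z $ k))"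
    if "norm z \<ge> 1" for z
  proof -
    let ?f = "\<lambda>k. ereal (inverse (a $ k)) * elog (cmod (z $ k))"
    have "S_dir a z = Max (range ?f)" unfolding S_dir_def by (simp add: Max_Sup)
    moreover have "Max (range ?f) \<in> range ?f" by (rule Max_in) auto
    ultimately have "S_dir a z \<in> range ?f" by (simp only:)
    then obtain k where k: "S_dir a z = ?f k" by (rule imageE)
    have le: "?f j \<le> S_dir a z" for j unfolding S_dir_def by (rule SUP_upper) simp
    have "\<exists>j. z $ j \<noteq> 0" using that by (metis norm_zero not_one_le_zero vec_eq_iff zero_index)
    then obtain j where "z $ j \<noteq> 0" by blast
    then have "?f j \<noteq> -\<infinity>" by (simp add: elog_def)
    then have "S_dir a z \<noteq> -\<infinity>" using le[of j] by auto
    then have zk: "z $ k \<noteq> 0" unfolding k using a[of k] by (auto simp: elog_def)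
    define r where "r = inverse (a $ k) * ln (cmod (z $ k))"
    have r: "S_dir a z = ereal r" unfolding k using zk by (simp add: elog_def r_def)
    have "cmod (z $ i) \<le> exp (a $ i * r)" for i
    proof (cases "z $ i = 0")
      case False
      then have "inverse (a $ i) * ln (cmod (z $ i)) \<le> r" using le[of i] r by (simp add: elog_def)
      then have "ln (cmod (z $ i)) \<le> a $ i * r" using a[of i] by (simp add: field_simps)
      then have "exp (ln (cmod (z $ i))) \<le> exp (a $ i * r)" by simp
      then show ?thesis using False by simp
    qed simp
    moreover have "exp (a $ k * r) = cmod (z $ k)" using zk a[of k] by (simp add: r_def flip: mult.assoc)
    ultimately show ?thesis using r by (metis order_refl)
  qed
  have ge1: "\<forall>\<^sub>F z in at_infinity. 1 \<le> norm (z :: complex ^ 'n)"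
    unfolding eventually_at_infinity by blast
  have "dir_lelong u a = Limsup at_infinity (\<lambda>z. u z / ereal (real_of_ereal (S_dir a z)))"
    unfolding dir_lelong_def
    by (intro Limsup_eq eventually_mono[OF ge1]) (use S in force)
  also have "\<dots> = psi u x a"
    by (rule growth_eq_psi[OF u a, where c = 0]; rule eventually_mono[OF ge1]) (use S in force)+
  finally show ?thesis .
qed

section \<open>The multitype\<close>

definition slice_at :: "complex ^ 'n \<Rightarrow> 'n \<Rightarrow> complex \<Rightarrow> complex ^ 'n" where
  "slice_at z k w = (\<chi> j. if j = k then w else z $ j)"

text \<open>
  A one-variable slice of \<open>u\<close> becomes a function on the whole space that depends on a single
  coordinate.  In this form the several-variable results apply to slices without change of
  dimension.
\<close>

lemma slice_in_Lclass:
  fixes u :: "complex ^ 'n \<Rightarrow> ereal"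
  assumes u: "u \<in> Lclass" and z: "u z \<noteq> -\<infinity>"
  shows "(\<lambda>y. u (slice_at z k (y $ k))) \<in> Lclass"
proof -
  have psh: "plurisubharmonic u" using u by (simp add: Lclass_def)
  obtain C1 C2 where C: "C1 \<ge> 0" "C2 \<ge> 0" "\<And>z. u z \<le> ereal (C1 * max 0 (ln (norm z)) + C2)"
    using u unfolding Lclass_def by blast
  have "plurisubharmonic (\<lambda>y. u (slice_at z k (y $ k)))"
    unfolding plurisubharmonic_def
  proof (intro conjI allI)
    have cont: "continuous_on UNIV (\<lambda>y :: complex ^ 'n. slice_at z k (y $ k))"
      unfolding slice_at_def
    proof (rule continuous_on_vec_lambda)
      show "continuous_on UNIV (\<lambda>y :: complex ^ 'n. if j = k then y $ k else z $ j)" for j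
        by (cases "j = k") (auto intro!: continuous_intros)
    qed
    show "upper_semicont (\<lambda>y. u (slice_at z k (y $ k)))"
      unfolding upper_semicont_def
    proof
      fix c
      have "open {z. u z < c}" using psh_usc[OF psh] by (simp add: upper_semicont_def)
      from open_vimage[OF this cont] show "open {y. u (slice_at z k (y $ k)) < c}" by (simp add: vimage_def)
    qed
    show "u (slice_at z k (y $ k)) < \<infinity>" for y by (rule psh_less_infinity[OF psh])
    have "slice_at z k (z $ k) = z" by (simp add: slice_at_def vec_eq_iff)
    then show "\<exists>y. u (slice_at z k (y $ k)) \<noteq> -\<infinity>" using z by metis
    fix a b :: "complex ^ 'n"
    have "slice_at z k ((a + w *s b) $ k) = slice_at z k (a $ k) + w *s axis k (b $ k)" for w
      by (simp add: slice_at_def vec_eq_iff axis_def)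
    then show "subharmonic (\<lambda>w. u (slice_at z k ((a + w *s b) $ k)))"
      using psh by (simp add: plurisubharmonic_def)
  qed
  moreover have "u (slice_at z k (y $ k)) \<le> ereal (C1 * max 0 (ln (norm y)) + (C1 * ln (1 + 2 * norm z) + C2))" for y
  proof -
    have ln_max: "max 0 (ln s) = ln (max 1 s)" if "s \<ge> 0" for s :: real
      using that ln_less_zero[of s] by (cases "s = 0") (auto simp: max_def)
    have "slice_at z k (y $ k) = z + axis k (y $ k - z $ k)"
      by (simp add: slice_at_def vec_eq_iff axis_def)
    then have "norm (slice_at z k (y $ k)) \<le> norm z + norm (axis k (y $ k - z $ k))"
      by (metis norm_triangle_ineq)
    also have "norm (axis k (y $ k - z $ k)) \<le> cmod (y $ k - z $ k)"
      using norm_le_sum_cmod[of "axis k (y $ k - z $ k)"]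
      by (simp add: axis_def if_distrib[of cmod] cong: if_cong)
    also have "\<dots> \<le> cmod (y $ k) + cmod (z $ k)" by (rule norm_triangle_ineq4)
    also have "\<dots> \<le> norm y + norm z" by (intro add_mono Finite_Cartesian_Product.norm_nth_le)
    finally have 1: "norm (slice_at z k (y $ k)) \<le> 2 * norm z + norm y" by simp
    have "2 * norm z * 1 \<le> 2 * norm z * max 1 (norm y)" by (intro mult_left_mono) auto
    then have "2 * norm z + norm y \<le> (1 + 2 * norm z) * max 1 (norm y)" by (simp add: distrib_right)
    moreover have "1 * 1 \<le> (1 + 2 * norm z) * max 1 (norm y)" by (intro mult_mono) auto
    ultimately have "max 1 (norm (slice_at z k (y $ k))) \<le> (1 + 2 * norm z) * max 1 (norm y)"
      using 1 by simp
    then have "ln (max 1 (norm (slice_at z k (y $ k)))) \<le> ln ((1 + 2 * norm z) * max 1 (norm y))"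
      by (intro ln_mono) auto
    also have "\<dots> = ln (1 + 2 * norm z) + ln (max 1 (norm y))"
      by (rule ln_mult_pos) (auto intro: add_pos_nonneg)
    finally have "max 0 (ln (norm (slice_at z k (y $ k)))) \<le> ln (1 + 2 * norm z) + max 0 (ln (norm y))"
      by (simp only: ln_max norm_ge_zero)
    from mult_left_mono[OF this C(1)]
    have "C1 * max 0 (ln (norm (slice_at z k (y $ k)))) + C2 \<le>
        C1 * max 0 (ln (norm y)) + (C1 * ln (1 + 2 * norm z) + C2)"
      by (simp only: distrib_left)
    then show ?thesis using C(3) by (meson ereal_less_eq(3) order_trans)
  qed
  moreover have "C1 * ln (1 + 2 * norm z) + C2 \<ge> 0" using C by simp
  ultimately show ?thesis unfolding Lclass_def using C(1) by blast
qed

text \<open>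
  A slice with fixed coordinates \<open>z\<^sub>j\<close> stays in polydiscs of logarithmic radii \<open>T \<^bold>1 + R \<^bold>1\<^sub>k\<close> with
  \<open>T\<close> fixed and \<open>\<^bold>1 = (1, \<dots>, 1)\<close>.
  Writing this vector as the midpoint of \<open>2 T \<^bold>1\<close> and \<open>2 R \<^bold>1\<^sub>k\<close>,
  convexity bounds \<open>F\<close> there by a constant plus \<open>R \<psi>(\<^bold>1\<^sub>k)\<close>.
\<close>

lemma slice_log_type_le_psi:
  fixes u :: "complex ^ 'n \<Rightarrow> ereal"
  assumes u: "u \<in> Lclass"
  shows "log_type (\<lambda>w. u (slice_at z k w)) \<le> psi u x (axis k 1)"
proof -
  have psh: "plurisubharmonic u" using u by (simp add: Lclass_def)
  define \<beta> where "\<beta> = psi_real u x (axis k 1)"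
  define T where "T = (\<Sum>j\<in>UNIV. ln (1 + cmod (z $ j - x $ j)))"
  have T: "cmod (z $ j - x $ j) \<le> exp T" for j
  proof -
    have "ln (1 + cmod (z $ j - x $ j)) \<le> T" unfolding T_def by (intro member_le_sum) auto
    then have "exp (ln (1 + cmod (z $ j - x $ j))) \<le> exp T" by simp
    then show ?thesis by (simp add: add_pos_nonneg)
  qed
  have "T \<ge> 0" unfolding T_def by (intro sum_nonneg) auto
  define \<alpha> where "\<alpha> = log_max u x ((2 * T) *\<^sub>R 1) / 2 + log_max u x 0 / 2"
  define R where "R r = ln (r + cmod (x $ k) + 1)" for r
  have bound: "u (slice_at z k w) \<le> ereal (\<alpha> + R (cmod w) * \<beta>)" for w
  proof -
    have R: "R (cmod w) \<ge> 0" by (simp add: R_def)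
    have "u (slice_at z k w) \<le> ereal (log_max u x (T *\<^sub>R 1 + R (cmod w) *\<^sub>R axis k 1))"
    proof (rule le_log_max[OF psh])
      fix j
      show "cmod (slice_at z k w $ j - x $ j) \<le> exp ((T *\<^sub>R 1 + R (cmod w) *\<^sub>R axis k 1) $ j)"
      proof (cases "j = k")
        case True
        have "cmod (w - x $ k) \<le> cmod w + cmod (x $ k)" by (rule norm_triangle_ineq4)
        also have "\<dots> \<le> exp (R (cmod w))" by (simp add: R_def add_nonneg_pos)
        also have "\<dots> \<le> exp (T + R (cmod w))" using \<open>T \<ge> 0\<close> by simp
        finally show ?thesis using True by (simp add: slice_at_def axis_def)
      qed (use T in \<open>simp add: slice_at_def axis_def\<close>)
    qed
    also have "log_max u x (T *\<^sub>R 1 + R (cmod w) *\<^sub>R axis k 1) \<le> \<alpha> + R (cmod w) * \<beta>"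
    proof -
      have "T *\<^sub>R 1 + R (cmod w) *\<^sub>R axis k 1
          = (1 - 1/2) *\<^sub>R ((2 * T) *\<^sub>R 1) + (1/2) *\<^sub>R ((2 * R (cmod w)) *\<^sub>R (axis k 1 :: real ^ 'n))"
        by simp
      then have "log_max u x (T *\<^sub>R 1 + R (cmod w) *\<^sub>R axis k 1)
          \<le> (1 - 1/2) * log_max u x ((2 * T) *\<^sub>R 1) + 1/2 * log_max u x ((2 * R (cmod w)) *\<^sub>R axis k 1)"
        using convex_onD[OF log_max_convex[OF psh, of x], of "1/2" "(2 * T) *\<^sub>R 1" "(2 * R (cmod w)) *\<^sub>R axis k 1"]
        by (simp only: ) auto
      also have "log_max u x ((2 * R (cmod w)) *\<^sub>R axis k 1) \<le> log_max u x 0 + (2 * R (cmod w)) * \<beta>"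
        unfolding \<beta>_def by (rule log_max_ray_le[OF u]) (use R in simp)
      finally show ?thesis by (simp add: \<alpha>_def add_divide_distrib)
    qed
    finally show ?thesis by simp
  qed
  have "((\<lambda>r. (\<alpha> + R r * \<beta>) / ln r) \<longlongrightarrow> \<beta>) at_top" unfolding R_def by real_asymp
  from filterlim_compose[OF this filterlim_norm_at_top]
  have lim: "((\<lambda>w::complex. ereal ((\<alpha> + R (cmod w) * \<beta>) / ln (cmod w))) \<longlongrightarrow> ereal \<beta>) at_infinity"
    by simp
  have "\<forall>\<^sub>F w in at_infinity. 2 \<le> cmod w"
    unfolding eventually_at_infinity by blast
  then have "\<forall>\<^sub>F w in at_infinity. u (slice_at z k w) / ereal (ln (cmod w)) \<le> ereal ((\<alpha> + R (cmod w) * \<beta>) / ln (cmod w))"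
  proof eventually_elim
    case (elim w)
    then have "ln (cmod w) > 0" by (intro ln_gt_zero) linarith
    then have "u (slice_at z k w) / ereal (ln (cmod w)) \<le> ereal (\<alpha> + R (cmod w) * \<beta>) / ereal (ln (cmod w))"
      by (intro ereal_divide_right_mono bound) simp
    then show ?case using \<open>ln (cmod w) > 0\<close> by simp
  qed
  then have "log_type (\<lambda>w. u (slice_at z k w)) \<le> Limsup at_infinity (\<lambda>w. ereal ((\<alpha> + R (cmod w) * \<beta>) / ln (cmod w)))"
    unfolding log_type_def by (rule Limsup_mono)
  also have "\<dots> = ereal \<beta>" by (intro lim_imp_Limsup trivial_limit_at_infinity lim)
  finally show ?thesis by (simp add: psi_eq_psi_real[OF u] \<beta>_def)
qed

text \<open>
  A point where the lifted slice attains its maximum over the torus of logarithmic radius \<open>R\<close> has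
  \<open>k\<close>-th coordinate \<open>w\<close> with \<open>|w - x\<^sub>k| = e\<^bsup>R\<^esup>\<close>, so \<open>log |w|\<close> differs from \<open>R\<close> by a bounded amount.
\<close>

lemma slice_psi_le_log_type:
  fixes u :: "complex ^ 'n \<Rightarrow> ereal"
  assumes u: "u \<in> Lclass" and z: "u z \<noteq> -\<infinity>"
  shows "psi (\<lambda>y. u (slice_at z k (y $ k))) x 1 \<le> log_type (\<lambda>w. u (slice_at z k w))"
proof -
  let ?v = "\<lambda>y. u (slice_at z k (y $ k))"
  have v: "?v \<in> Lclass" by (rule slice_in_Lclass[OF u z])
  then have psh: "plurisubharmonic ?v" by (simp add: Lclass_def)
  have "\<forall>R. \<exists>y. (\<forall>j. cmod (y $ j - x $ j) = exp ((R *\<^sub>R 1) $ j)) \<and> ?v y = ereal (log_max ?v x (R *\<^sub>R 1))"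
    using log_max_attained[OF psh] by metis
  then obtain y where y: "\<And>R j. cmod (y R $ j - x $ j) = exp ((R *\<^sub>R 1) $ j)"
      "\<And>R. ?v (y R) = ereal (log_max ?v x (R *\<^sub>R 1))"
    by metis
  define w where "w R = y R $ k" for R
  have w: "cmod (w R - x $ k) = exp R" for R using y(1)[of R k] by (simp add: w_def)
  have le: "cmod (w R) \<le> exp R + cmod (x $ k)" and ge: "exp R \<le> cmod (w R) + cmod (x $ k)" for R
    using w[of R] norm_triangle_ineq[of "w R - x $ k" "x $ k"] norm_triangle_ineq4[of "w R" "x $ k"] by auto
  have norm_w: "filterlim (\<lambda>R. cmod (w R)) at_top at_top"
  proof (rule filterlim_at_top_mono)
    show "filterlim (\<lambda>R. - cmod (x $ k) + exp R) at_top at_top"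
      by (rule filterlim_tendsto_add_at_top[OF tendsto_const exp_at_top])
    show "\<forall>\<^sub>F R in at_top. - cmod (x $ k) + exp R \<le> cmod (w R)"
      using ge by (intro always_eventually) (simp add: algebra_simps)
  qed
  then have w_inf: "filterlim w at_infinity at_top"
    by (rule filterlim_norm_at_top_imp_at_infinity)
  define d where "d = ln (1 + cmod (x $ k))"
  have ed: "exp d = 1 + cmod (x $ k)" by (simp add: d_def add_pos_nonneg)
  have "\<forall>\<^sub>F R in at_top. 1 \<le> cmod (w R)" using norm_w by (simp add: filterlim_at_top)
  then have "\<forall>\<^sub>F R in at_top. \<bar>ln (cmod (w R)) - R\<bar> \<le> d"
    using eventually_ge_at_top[of 0]
  proof eventually_elim
    case (elim R)
    have eL: "exp (ln (cmod (w R))) = cmod (w R)" using elim by (intro exp_ln) linarith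
    have "cmod (x $ k) * 1 \<le> cmod (x $ k) * exp R" using elim by (intro mult_left_mono) auto
    then have "exp (ln (cmod (w R))) \<le> exp (R + d)" using le[of R] by (simp add: eL exp_add ed algebra_simps)
    moreover have "cmod (x $ k) * 1 \<le> cmod (x $ k) * cmod (w R)" using elim by (intro mult_left_mono) auto
    then have "exp R \<le> exp (ln (cmod (w R)) + d)" using ge[of R] by (simp add: eL exp_add ed algebra_simps)
    ultimately show ?case unfolding exp_le_cancel_iff by linarith
  qed
  from ratio_tendsto[OF log_max_tendsto[OF v, of x 1] this]
  have "((\<lambda>R. ereal (log_max ?v x (R *\<^sub>R 1) / ln (cmod (w R)))) \<longlongrightarrow> psi ?v x 1) at_top"
    by (simp add: psi_eq_psi_real[OF v])
  moreover have "\<forall>\<^sub>F R in at_top. 2 \<le> cmod (w R)" using norm_w by (simp add: filterlim_at_top)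
  then have "\<forall>\<^sub>F R in at_top. u (slice_at z k (w R)) / ereal (ln (cmod (w R))) = ereal (log_max ?v x (R *\<^sub>R 1) / ln (cmod (w R)))"
  proof eventually_elim
    case (elim R)
    then have "ln (cmod (w R)) > 0" by (intro ln_gt_zero) linarith
    then show ?case using y(2)[of R] by (simp add: w_def)
  qed
  ultimately have "((\<lambda>R. u (slice_at z k (w R)) / ereal (ln (cmod (w R)))) \<longlongrightarrow> psi ?v x 1) at_top"
    by (simp add: tendsto_cong)
  then show ?thesis unfolding log_type_def by (intro le_Limsup_along[OF w_inf]) auto
qed

text \<open>
  For \<open>\<ge>\<close>, let \<open>z\<close> be a point of the torus of logarithmic radius \<open>R 1\<^sub>k\<close> where \<open>u\<close> attains its maximum.
  The slice of \<open>u\<close> through \<open>z\<close> in the \<open>k\<close>-th direction has slope at infinity at most \<open>\<sigma>\<^sub>k(u)\<close>, and on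
  the circle of radius \<open>1\<close> about \<open>x\<^sub>k\<close> it is bounded by \<open>F(0)\<close>, so
  \<open>F(R 1\<^sub>k) = u(z) \<le> F(0) + R \<sigma>\<^sub>k(u)\<close>.  Dividing by \<open>R\<close> yields \<open>\<psi>(1\<^sub>k) \<le> \<sigma>\<^sub>k(u)\<close>.  The slice varies with \<open>R\<close>, which does no harm because the bound is
  uniform.
\<close>

lemma multitype_eq_psi:
  fixes u :: "complex ^ 'n \<Rightarrow> ereal"
  assumes u: "u \<in> Lclass"
  shows "multitype u k = psi u x (axis k 1)"
proof (rule antisym)
  have psh: "plurisubharmonic u" using u by (simp add: Lclass_def)
  have mt: "multitype u k = (SUP z. log_type (\<lambda>w. u (slice_at z k w)))"
    unfolding multitype_def slice_at_def ..
  show "multitype u k \<le> psi u x (axis k 1)"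
    unfolding mt by (intro SUP_least slice_log_type_le_psi u)
  have "ereal ((log_max u x (R *\<^sub>R axis k 1) - log_max u x 0) / R) \<le> multitype u k" if R: "R > 0" for R
  proof -
    obtain z where z: "\<And>j. cmod (z $ j - x $ j) = exp ((R *\<^sub>R axis k 1) $ j)"
      "u z = ereal (log_max u x (R *\<^sub>R axis k 1))"
      using log_max_attained[OF psh] by metis
    let ?v = "\<lambda>y. u (slice_at z k (y $ k))"
    have z': "u z \<noteq> -\<infinity>" using z by simp
    have v: "?v \<in> Lclass" by (rule slice_in_Lclass[OF u z'])
    then have pshv: "plurisubharmonic ?v" by (simp add: Lclass_def)
    have "slice_at z k (z $ k) = z" by (simp add: slice_at_def vec_eq_iff)
    then have "ereal (log_max u x (R *\<^sub>R axis k 1)) = ?v z" using z by simp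
    also have "\<dots> \<le> ereal (log_max ?v x (R *\<^sub>R 1))"
      by (rule le_log_max[OF pshv]) (use R in \<open>simp add: z axis_def\<close>)
    also have "\<dots> \<le> ereal (log_max ?v x 0 + R * psi_real ?v x 1)"
      using log_max_ray_le[OF v, of R x 1] R by simp
    also have "log_max ?v x 0 \<le> log_max u x 0"
    proof -
      obtain y where y: "\<And>j. cmod (y $ j - x $ j) = exp ((0 :: real ^ 'n) $ j)" "?v y = ereal (log_max ?v x 0)"
        using log_max_attained[OF pshv] by metis
      have "?v y \<le> ereal (log_max u x 0)"
        by (rule le_log_max[OF psh]) (use y(1) z(1) in \<open>auto simp: slice_at_def axis_def\<close>)
      then show ?thesis using y by simp
    qed
    finally have "(log_max u x (R *\<^sub>R axis k 1) - log_max u x 0) / R \<le> psi_real ?v x 1"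
      using R by (simp add: field_simps)
    then have "ereal ((log_max u x (R *\<^sub>R axis k 1) - log_max u x 0) / R) \<le> psi ?v x 1"
      by (simp add: psi_eq_psi_real[OF v])
    also have "\<dots> \<le> log_type (\<lambda>w. u (slice_at z k w))" by (rule slice_psi_le_log_type[OF u z'])
    also have "\<dots> \<le> multitype u k" unfolding mt by (rule SUP_upper) simp
    finally show ?thesis .
  qed
  then have "\<forall>\<^sub>F R in at_top. ereal ((log_max u x (R *\<^sub>R axis k 1) - log_max u x 0) / R) \<le> multitype u k"
    by (intro eventually_mono[OF eventually_gt_at_top[of 0]])
  moreover have "((\<lambda>R. log_max u x (R *\<^sub>R axis k 1) / R - log_max u x 0 / R) \<longlongrightarrow> psi_real u x (axis k 1) - 0) at_top"
    by (intro tendsto_diff log_max_tendsto[OF u] const_over_tendsto_0)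
  then have "((\<lambda>R. ereal ((log_max u x (R *\<^sub>R axis k 1) - log_max u x 0) / R)) \<longlongrightarrow> psi u x (axis k 1)) at_top"
    by (simp add: diff_divide_distrib psi_eq_psi_real[OF u])
  ultimately show "psi u x (axis k 1) \<le> multitype u k"
    by (intro tendsto_upperbound) auto
qed

section \<open>Plurisubharmonic functions from convex functions of the logarithms\<close>

text \<open>
  Submean inequalities pass to decreasing limits.  Monotone convergence is applied separately to
  the positive parts, whose integrals are finite, and to the negative parts.
\<close>

lemma le_circle_mean_decseq:
  fixes f :: "nat \<Rightarrow> real \<Rightarrow> real"
  assumes cont: "\<And>n. continuous_on UNIV (f n)" and dec: "\<And>n \<theta>. f (Suc n) \<theta> \<le> f n \<theta>"
    and v: "\<And>\<theta>. v (c + of_real r * cis \<theta>) = (INF n. ereal (f n \<theta>))"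
    and b: "\<And>n. b \<le> ereal (integral {0..2*pi} (f n) / (2*pi))"
  shows "b \<le> circle_mean v c r"
proof -
  define A where "A n = (\<integral>\<^sup>+\<theta>\<in>{0..2*pi}. e2ennreal (ereal (f n \<theta>)) \<partial>lborel)" for n
  define B where "B n = (\<integral>\<^sup>+\<theta>\<in>{0..2*pi}. e2ennreal (- ereal (f n \<theta>)) \<partial>lborel)" for n
  define w where "w \<theta> = (INF n. ereal (f n \<theta>))" for \<theta>
  define A' where "A' = (\<integral>\<^sup>+\<theta>\<in>{0..2*pi}. e2ennreal (w \<theta>) \<partial>lborel)"
  define B' where "B' = (\<integral>\<^sup>+\<theta>\<in>{0..2*pi}. e2ennreal (- w \<theta>) \<partial>lborel)"
  have con: "continuous_on {0..2*pi} (f n)" for n using cont continuous_on_subset by blast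
  have [measurable]: "f n \<in> borel_measurable borel" for n
    by (rule borel_measurable_continuous_onI[OF cont])
  have dec': "decseq (\<lambda>n. ereal (f n \<theta>))" for \<theta> by (rule decseq_SucI) (simp add: dec)
  have lim: "(\<lambda>n. ereal (f n \<theta>)) \<longlonglongrightarrow> w \<theta>" for \<theta>
    unfolding w_def by (rule LIMSEQ_INF[OF dec'])
  have "A \<longlonglongrightarrow> A'"
  proof -
    let ?g = "\<lambda>n \<theta>. e2ennreal (ereal (f n \<theta>)) * indicator {0..2*pi} \<theta>"
    have dg: "decseq ?g"
      by (rule decseq_SucI) (auto simp: le_fun_def indicator_def dec intro!: ennreal_leI)
    have "(\<integral>\<^sup>+\<theta>. (INF n. ?g n \<theta>) \<partial>lborel) = (INF n. A n)"
      unfolding A_def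
    proof (rule nn_integral_monotone_convergence_INF_decseq[OF dg])
      show "(\<integral>\<^sup>+\<theta>. ?g 0 \<theta> \<partial>lborel) < \<infinity>" using nn_integral_positive_part[OF con] by simp
    qed simp
    moreover have "(INF n. ?g n \<theta>) = e2ennreal (w \<theta>) * indicator {0..2*pi} \<theta>" for \<theta>
    proof (rule LIMSEQ_unique[OF LIMSEQ_INF])
      show "decseq (\<lambda>n. ?g n \<theta>)"
        by (rule decseq_SucI) (auto simp: indicator_def dec intro!: ennreal_leI)
      show "(\<lambda>n. ?g n \<theta>) \<longlonglongrightarrow> e2ennreal (w \<theta>) * indicator {0..2*pi} \<theta>"
        using tendsto_e2ennrealI[OF lim[of \<theta>]] by (cases "\<theta> \<in> {0..2*pi}") (simp_all del: e2ennreal_ereal)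
    qed
    moreover have "decseq A"
      unfolding A_def by (rule decseq_SucI)
        (auto intro!: nn_integral_mono ennreal_leI dec mult_right_mono)
    ultimately show ?thesis using LIMSEQ_INF[of A] by (simp add: A'_def)
  qed
  moreover have "B \<longlonglongrightarrow> B'"
  proof -
    let ?g = "\<lambda>n \<theta>. e2ennreal (- ereal (f n \<theta>)) * indicator {0..2*pi} \<theta>"
    have ig: "incseq ?g"
      by (rule incseq_SucI) (auto simp: le_fun_def indicator_def dec intro!: ennreal_leI)
    have "(\<integral>\<^sup>+\<theta>. (SUP n. ?g n \<theta>) \<partial>lborel) = (SUP n. B n)"
      unfolding B_def by (rule nn_integral_monotone_convergence_SUP[OF ig]) simp
    moreover have "(SUP n. ?g n \<theta>) = e2ennreal (- w \<theta>) * indicator {0..2*pi} \<theta>" for \<theta>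
    proof (rule LIMSEQ_unique[OF LIMSEQ_SUP])
      show "incseq (\<lambda>n. ?g n \<theta>)"
        by (rule incseq_SucI) (auto simp: indicator_def dec intro!: ennreal_leI)
      have "(\<lambda>n. - ereal (f n \<theta>)) \<longlonglongrightarrow> - w \<theta>" using lim[of \<theta>] by (simp only: ereal_Lim_uminus[symmetric])
      then show "(\<lambda>n. ?g n \<theta>) \<longlonglongrightarrow> e2ennreal (- w \<theta>) * indicator {0..2*pi} \<theta>"
        using tendsto_e2ennrealI by (cases "\<theta> \<in> {0..2*pi}") (simp_all del: e2ennreal_ereal uminus_ereal.simps)
    qed
    moreover have "incseq B"
      unfolding B_def by (rule incseq_SucI)
        (auto intro!: nn_integral_mono ennreal_leI dec mult_right_mono)
    ultimately show ?thesis using LIMSEQ_SUP[of B] by (simp add: B'_def)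
  qed
  moreover have "enn2ereal A' \<noteq> \<infinity>"
  proof -
    have "A' \<le> A 0"
      unfolding A'_def A_def w_def by (intro nn_integral_mono mult_right_mono e2ennreal_mono INF_lower) auto
    also have "A 0 < \<infinity>" unfolding A_def nn_integral_positive_part[OF con] by simp
    finally show ?thesis by (cases A') (auto simp: enn2ereal_ennreal)
  qed
  ultimately have AB: "(\<lambda>n. enn2ereal (A n) - enn2ereal (B n)) \<longlonglongrightarrow> enn2ereal A' - enn2ereal B'"
    by (intro tendsto_diff_ereal_general tendsto_enn2erealI) auto
  have "ereal (2*pi) * b \<le> enn2ereal (A n) - enn2ereal (B n)" for n
  proof -
    have "b \<le> ereal (integral {0..2*pi} (f n)) / ereal (2*pi)" using b[of n] by simp
    then have "ereal (2*pi) * b \<le> ereal (integral {0..2*pi} (f n))"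
      by (subst (asm) ereal_le_divide_pos) auto
    then show ?thesis unfolding A_def B_def integral_via_parts[OF con] .
  qed
  then have "ereal (2*pi) * b \<le> enn2ereal A' - enn2ereal B'" by (intro LIMSEQ_le_const[OF AB]) auto
  then have "b \<le> (enn2ereal A' - enn2ereal B') / ereal (2*pi)"
    by (subst ereal_le_divide_pos) auto
  then show ?thesis unfolding circle_mean_def v A'_def B'_def w_def .
qed

text \<open>
  Jensen's inequality in several variables: the mean of a curve in the closed convex epigraph of
  \<open>g\<close> stays in the epigraph, since otherwise a hyperplane would separate it from the curve.
\<close>

lemma convex_Jensen_circle:
  fixes g :: "'a::euclidean_space \<Rightarrow> real" and T :: "real \<Rightarrow> 'a"
  assumes g: "convex_on UNIV g" and T: "continuous_on {0..2*pi} T"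
  shows "g ((1 / (2*pi)) *\<^sub>R integral {0..2*pi} T) \<le> integral {0..2*pi} (\<lambda>\<theta>. g (T \<theta>)) / (2*pi)"
proof (rule ccontr)
  let ?m = "(1 / (2*pi)) *\<^sub>R integral {0..2*pi} T" and ?M = "integral {0..2*pi} (\<lambda>\<theta>. g (T \<theta>)) / (2*pi)"
  have cont: "continuous_on UNIV g" by (rule convex_on_continuous[OF open_UNIV g])
  have gT: "continuous_on {0..2*pi} (\<lambda>\<theta>. g (T \<theta>))"
    by (rule continuous_on_compose2[OF cont T]) auto
  assume "\<not> g ?m \<le> ?M"
  then have out: "(?m, ?M) \<notin> epigraph UNIV g" by (simp add: epigraph_def)
  have "closed (epigraph UNIV g)"
  proof -
    have "epigraph UNIV g = {p. g (fst p) \<le> snd p}" by (auto simp: epigraph_def)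
    moreover have "closed {p. g (fst p) \<le> snd p}"
      by (intro closed_Collect_le continuous_on_compose2[OF cont] continuous_intros) auto
    ultimately show ?thesis by simp
  qed
  moreover have "convex (epigraph UNIV g)" using g by (simp add: convex_epigraph)
  ultimately obtain a b where ab: "a \<bullet> (?m, ?M) < b" "\<And>p. p \<in> epigraph UNIV g \<Longrightarrow> a \<bullet> p > b"
    using separating_hyperplane_closed_point[OF _ _ out] by blast
  obtain a1 a2 where a: "a = (a1, a2)" by (cases a)
  have int: "((\<lambda>\<theta>. a1 \<bullet> T \<theta> + a2 * g (T \<theta>)) has_integral
      (a1 \<bullet> integral {0..2*pi} T + a2 * integral {0..2*pi} (\<lambda>\<theta>. g (T \<theta>)))) {0..2*pi}"
  proof (intro has_integral_add has_integral_mult_right)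
    have "(T has_integral integral {0..2*pi} T) {0..2*pi}"
      by (intro integrable_integral integrable_continuous_interval T)
    from has_integral_linear[OF this bounded_linear_inner_right[of a1]]
    show "((\<lambda>\<theta>. a1 \<bullet> T \<theta>) has_integral a1 \<bullet> integral {0..2*pi} T) {0..2*pi}" by (simp add: o_def)
    show "((\<lambda>\<theta>. g (T \<theta>)) has_integral integral {0..2*pi} (\<lambda>\<theta>. g (T \<theta>))) {0..2*pi}"
      by (intro integrable_integral integrable_continuous_interval gT)
  qed
  have "((\<lambda>\<theta>. b) has_integral (2*pi * b)) {0..2*pi}"
    using has_integral_const_real[of b 0 "2*pi"] by simp
  then have "2*pi * b \<le> a1 \<bullet> integral {0..2*pi} T + a2 * integral {0..2*pi} (\<lambda>\<theta>. g (T \<theta>))"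
    by (rule has_integral_le[OF _ int]) (use ab(2)[of "(T _, g (T _))"] in \<open>auto simp: epigraph_def a less_imp_le\<close>)
  moreover have "2*pi * (a \<bullet> (?m, ?M)) = a1 \<bullet> integral {0..2*pi} T + a2 * integral {0..2*pi} (\<lambda>\<theta>. g (T \<theta>))"
    by (simp add: a field_simps)
  moreover have "2*pi * (a \<bullet> (?m, ?M)) < 2*pi * b" using ab(1) by (intro mult_strict_left_mono) auto
  ultimately show False by linarith
qed

text \<open>
  On the circle the function \<open>|a + b e\<^bsup>i\<theta>\<^esup>|\<^sup>2 + \<delta>\<close> is a strictly positive trigonometric polynomial
  of degree at most one, hence equal to \<open>A |1 + c e\<^bsup>i\<theta>\<^esup>|\<^sup>2\<close> with \<open>|c| < 1\<close> (Fejer-Riesz).  The mean of its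
  logarithm is therefore exactly \<open>log A\<close>, and \<open>A\<close> is at least \<open>|a|\<^sup>2 + \<delta>\<close>.
\<close>

lemma ln_norm_squared_submean:
  fixes a b :: complex
  assumes "\<delta> > 0"
  shows "ln ((cmod a)\<^sup>2 + \<delta>) \<le> integral {0..2*pi} (\<lambda>\<theta>. ln ((cmod (a + cis \<theta> * b))\<^sup>2 + \<delta>)) / (2*pi)"
proof -
  define P where "P = (cmod a)\<^sup>2 + (cmod b)\<^sup>2 + \<delta>"
  define q where "q = cnj a * b"
  have q: "cmod q = cmod a * cmod b" by (simp add: q_def norm_mult)
  have "0 \<le> (cmod a - cmod b)\<^sup>2" by simp
  then have Pq: "P > 2 * cmod q" using assms by (simp add: P_def q power2_eq_square algebra_simps)
  define D where "D = P\<^sup>2 - 4 * (cmod q)\<^sup>2"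
  \<comment> \<open>\<open>A\<close> is the larger root of \<open>A\<^sup>2 - P A + |q|\<^sup>2 = 0\<close>, so that \<open>A + |q|\<^sup>2 / A = P\<close>.\<close>
  define A where "A = (P + sqrt D) / 2"
  have "(2 * cmod q)\<^sup>2 \<le> P\<^sup>2" using Pq by (intro power_mono) auto
  then have D: "D \<ge> 0" by (simp add: D_def power_mult_distrib)
  have "sqrt D \<ge> 0" using D by simp
  moreover have "2 * A = P + sqrt D" by (simp add: A_def)
  ultimately have "A > cmod q" using Pq by linarith
  then have A: "A > cmod q" "A > 0" using le_less_trans[OF norm_ge_zero] by blast+
  have "A * A - P * A + (cmod q)\<^sup>2 = ((sqrt D)\<^sup>2 - P\<^sup>2 + 4 * (cmod q)\<^sup>2) / 4"
    by (simp add: A_def power2_eq_square field_simps)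
  then have AP: "A * A - P * A + (cmod q)\<^sup>2 = 0" using D by (simp add: D_def)
  have ge: "(cmod a)\<^sup>2 + \<delta> \<le> A"
  proof -
    let ?s = "2 * ((cmod a)\<^sup>2 + \<delta>) - P"
    have "D - ?s\<^sup>2 = 4 * \<delta> * (cmod b)\<^sup>2"
      by (simp add: D_def P_def q power2_eq_square algebra_simps)
    then have "?s\<^sup>2 \<le> D" using assms by (metis diff_ge_0_iff_ge mult_nonneg_nonneg less_imp_le zero_le_numeral zero_le_power2)
    then have "?s \<le> sqrt D" by (rule real_le_rsqrt)
    then show ?thesis by (simp add: A_def)
  qed
  define c where "c = q / of_real A"
  have c: "cmod c < 1" using A by (simp add: c_def norm_divide)
  have eq: "ln ((cmod (a + cis \<theta> * b))\<^sup>2 + \<delta>) = ln A + 2 * ln (cmod (1 + c * cis \<theta>))" for \<theta>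
  proof -
    have n: "(cmod (s + t))\<^sup>2 = (cmod s)\<^sup>2 + 2 * Re (cnj s * t) + (cmod t)\<^sup>2" for s t
      unfolding cmod_power2 by (simp add: power2_eq_square algebra_simps)
    have "(cmod (a + cis \<theta> * b))\<^sup>2 + \<delta> = P + 2 * Re (q * cis \<theta>)"
      unfolding n by (simp add: P_def q_def norm_mult mult_ac)
    also have "\<dots> = A * (cmod (1 + c * cis \<theta>))\<^sup>2"
    proof -
      have "A * (cmod (1 + c * cis \<theta>))\<^sup>2 = A + 2 * (A * Re (c * cis \<theta>)) + A * (cmod c)\<^sup>2"
        unfolding n by (simp add: norm_mult algebra_simps)
      also have "A * Re (c * cis \<theta>) = Re (q * cis \<theta>)" using A by (simp add: c_def)
      also have "A * (cmod c)\<^sup>2 = P - A"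
        using A AP by (simp add: c_def norm_divide power_divide power2_eq_square field_simps)
      finally show ?thesis by simp
    qed
    finally have e: "(cmod (a + cis \<theta> * b))\<^sup>2 + \<delta> = A * (cmod (1 + c * cis \<theta>))\<^sup>2" .
    have "cmod (1 + c * cis \<theta>) > 0"
    proof -
      have "cmod (c * cis \<theta>) < 1" using c by (simp add: norm_mult)
      then have "1 + c * cis \<theta> \<noteq> 0" by (metis add_eq_0_iff norm_minus_cancel norm_one less_irrefl)
      then show ?thesis by simp
    qed
    then show ?thesis unfolding e using A by (simp add: ln_mult ln_realpow)
  qed
  have "((\<lambda>\<theta>. ln A + 2 * ln (cmod (1 + c * cis \<theta>))) has_integral (2*pi * ln A + 2 * 0)) {0..2*pi}"
    by (intro has_integral_add has_integral_mult_right integral_ln_cmod_one_plus_cis c)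
       (use has_integral_const_real[of "ln A" 0 "2*pi"] in simp)
  then have "integral {0..2*pi} (\<lambda>\<theta>. ln ((cmod (a + cis \<theta> * b))\<^sup>2 + \<delta>)) / (2*pi) = ln A"
    unfolding eq by (simp add: integral_unique)
  moreover have "ln ((cmod a)\<^sup>2 + \<delta>) \<le> ln A"
    using ge assms by (intro ln_mono) (auto intro: add_nonneg_pos)
  ultimately show ?thesis by simp
qed

text \<open>
  A smoothing of \<open>(log |y\<^sub>1|, \<dots>, log |y\<^sub>n|)\<close> that is finite on the coordinate
  hyperplanes, chosen such that the means of its components over circles are explicit.
\<close>

definition log_vec :: "real \<Rightarrow> complex ^ 'n \<Rightarrow> real ^ 'n" where
  "log_vec \<delta> y = (\<chi> k. ln ((cmod (y $ k))\<^sup>2 + \<delta>) / 2)"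

definition reinhardt_ext :: "(real ^ 'n \<Rightarrow> real) \<Rightarrow> complex ^ 'n \<Rightarrow> ereal" where
  "reinhardt_ext g y = (INF n. ereal (g (log_vec (inverse (real (Suc n))) y)))"

lemma continuous_on_log_vec:
  assumes "\<delta> > 0" "continuous_on S Y"
  shows "continuous_on S (\<lambda>s. log_vec \<delta> (Y s))"
  unfolding log_vec_def
  by (intro continuous_intros assms) (use assms in \<open>auto simp: add_nonneg_eq_0_iff\<close>)

text \<open>
  Each component of \<open>log_vec\<close> is subharmonic on lines.  As \<open>g\<close> is nondecreasing, \<open>g\<close> at the centre is
  at most \<open>g\<close> of the mean vector, and Jensen's inequality finishes the argument.
\<close>

lemma reinhardt_submean:
  fixes g :: "real ^ 'n \<Rightarrow> real"
  assumes g: "convex_on UNIV g" and mono: "\<And>s t. (\<And>k. s $ k \<le> t $ k) \<Longrightarrow> g s \<le> g t" and \<delta>: "\<delta> > 0"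
  shows "g (log_vec \<delta> a) \<le> integral {0..2*pi} (\<lambda>\<theta>. g (log_vec \<delta> (a + cis \<theta> *s b))) / (2*pi)"
proof -
  let ?T = "\<lambda>\<theta>. log_vec \<delta> (a + cis \<theta> *s b)"
  have "continuous_on {0..2*pi} (\<lambda>\<theta>. a + cis \<theta> *s b)"
    unfolding vector_scalar_mult_def by (intro continuous_intros)
  then have cont: "continuous_on {0..2*pi} ?T" by (intro continuous_on_log_vec \<delta>)
  have "g (log_vec \<delta> a) \<le> g ((1 / (2*pi)) *\<^sub>R integral {0..2*pi} ?T)"
  proof (rule mono)
    fix k
    have "integral {0..2*pi} ?T $ k = integral {0..2*pi} (\<lambda>\<theta>. ?T \<theta> $ k)"
      using integral_component_eq_cart[OF integrable_continuous_interval[OF cont]] by simp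
    also have "\<dots> = integral {0..2*pi} (\<lambda>\<theta>. ln ((cmod (a $ k + cis \<theta> * b $ k))\<^sup>2 + \<delta>)) / 2"
      by (simp add: log_vec_def)
    finally show "log_vec \<delta> a $ k \<le> ((1 / (2*pi)) *\<^sub>R integral {0..2*pi} ?T) $ k"
      using ln_norm_squared_submean[OF \<delta>, of "a $ k" "b $ k"]
      by (simp add: log_vec_def field_simps)
  qed
  also have "\<dots> \<le> integral {0..2*pi} (\<lambda>\<theta>. g (?T \<theta>)) / (2*pi)"
    by (rule convex_Jensen_circle[OF g cont])
  finally show ?thesis .
qed

lemma log_vec_mono:
  assumes "0 < \<delta>" "\<delta> \<le> \<delta>'"
  shows "log_vec \<delta> y $ k \<le> log_vec \<delta>' y $ k"
proof -
  have "0 < (cmod (y $ k))\<^sup>2 + \<delta>" using assms by (intro add_nonneg_pos) auto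
  then show ?thesis using assms by (simp add: log_vec_def)
qed

lemma reinhardt_ext_off_axes:
  fixes g :: "real ^ 'n \<Rightarrow> real"
  assumes g: "convex_on UNIV g" and mono: "\<And>s t. (\<And>k. s $ k \<le> t $ k) \<Longrightarrow> g s \<le> g t"
    and y: "\<And>k. y $ k \<noteq> 0"
  shows "reinhardt_ext g y = ereal (g (\<chi> k. ln (cmod (y $ k))))"
proof -
  let ?X = "\<lambda>n. ereal (g (log_vec (inverse (real (Suc n))) y))"
  have gcont: "continuous_on UNIV g" by (rule convex_on_continuous[OF open_UNIV g])
  have "decseq ?X"
    by (rule decseq_SucI) (auto intro!: mono log_vec_mono le_imp_inverse_le)
  then have "?X \<longlonglongrightarrow> reinhardt_ext g y" unfolding reinhardt_ext_def by (rule LIMSEQ_INF)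
  moreover have "?X \<longlonglongrightarrow> ereal (g (\<chi> k. ln (cmod (y $ k))))"
  proof -
    have "(\<lambda>n. ln ((cmod (y $ k))\<^sup>2 + inverse (real (Suc n))) / 2) \<longlonglongrightarrow> ln ((cmod (y $ k))\<^sup>2 + 0) / 2" for k
      using y[of k] by (intro tendsto_intros LIMSEQ_inverse_real_of_nat) auto
    moreover have "ln ((cmod (y $ k))\<^sup>2 + 0) / 2 = ln (cmod (y $ k))" for k
      using y[of k] by (simp add: ln_realpow)
    ultimately have "(\<lambda>n. log_vec (inverse (real (Suc n))) y) \<longlonglongrightarrow> (\<chi> k. ln (cmod (y $ k)))"
      unfolding log_vec_def by (intro tendsto_vec_lambda) simp
    then have "(\<lambda>n. g (log_vec (inverse (real (Suc n))) y)) \<longlonglongrightarrow> g (\<chi> k. ln (cmod (y $ k)))"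
      using gcont by (intro continuous_on_tendsto_compose[OF gcont]) auto
    then show ?thesis by simp
  qed
  ultimately show ?thesis by (rule LIMSEQ_unique)
qed

lemma plurisubharmonic_reinhardt_ext:
  fixes g :: "real ^ 'n \<Rightarrow> real"
  assumes g: "convex_on UNIV g" and mono: "\<And>s t. (\<And>k. s $ k \<le> t $ k) \<Longrightarrow> g s \<le> g t"
  shows "plurisubharmonic (reinhardt_ext g)"
proof -
  define G where "G n y = g (log_vec (inverse (real (Suc n))) y)" for n y
  have ext: "reinhardt_ext g y = (INF n. ereal (G n y))" for y by (simp add: reinhardt_ext_def G_def)
  have gcont: "continuous_on UNIV g" by (rule convex_on_continuous[OF open_UNIV g])
  have Gcont: "continuous_on S (\<lambda>s. G n (Y s))" if "continuous_on S Y" for S :: "'b::topological_space set" and Y n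
    unfolding G_def by (intro continuous_on_compose2[OF gcont continuous_on_log_vec[OF _ that]]) auto
  have Gdec: "G (Suc n) y \<le> G n y" for n y
    unfolding G_def by (intro mono log_vec_mono le_imp_inverse_le) auto
  have lt: "reinhardt_ext g y < \<infinity>" for y
  proof -
    have "reinhardt_ext g y \<le> ereal (G 0 y)" unfolding ext by (rule INF_lower[of 0]) simp
    then show ?thesis by (rule le_less_trans) simp
  qed
  have open_lt: "open {y. reinhardt_ext g y < c}" for c
  proof -
    have "{y. reinhardt_ext g y < c} = (\<Union>n. {y. ereal (G n y) < c})"
      unfolding ext by (auto simp: INF_less_iff)
    moreover have "open {y. ereal (G n y) < c}" for n
      by (intro open_Collect_less continuous_intros Gcont)
    ultimately show ?thesis by (simp add: open_UN)
  qed
  have mean: "reinhardt_ext g (a + c *s b) \<le> circle_mean (\<lambda>w. reinhardt_ext g (a + w *s b)) c r" for a b c r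
  proof (rule le_circle_mean_decseq)
    let ?Y = "\<lambda>\<theta>. (a + c *s b) + cis \<theta> *s (of_real r *s b)"
    have "continuous_on UNIV ?Y" unfolding vector_scalar_mult_def by (intro continuous_intros)
    then show "continuous_on UNIV (\<lambda>\<theta>. G n (?Y \<theta>))" for n by (rule Gcont)
    show "G (Suc n) (?Y \<theta>) \<le> G n (?Y \<theta>)" for n \<theta> by (rule Gdec)
    have "a + (c + of_real r * cis \<theta>) *s b = ?Y \<theta>" for \<theta>
      by (simp add: vec_eq_iff algebra_simps)
    then show "reinhardt_ext g (a + (c + of_real r * cis \<theta>) *s b) = (INF n. ereal (G n (?Y \<theta>)))" for \<theta>
      by (simp only: ext)
    fix n
    have "reinhardt_ext g (a + c *s b) \<le> ereal (G n (a + c *s b))" unfolding ext by (rule INF_lower[of n]) simp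
    also have "\<dots> \<le> ereal (integral {0..2*pi} (\<lambda>\<theta>. G n (?Y \<theta>)) / (2*pi))"
      unfolding G_def ereal_less_eq by (rule reinhardt_submean[OF g mono]) auto
    finally show "reinhardt_ext g (a + c *s b) \<le> ereal (integral {0..2*pi} (\<lambda>\<theta>. G n (?Y \<theta>)) / (2*pi))" .
  qed
  show ?thesis
    unfolding plurisubharmonic_def subharmonic_def
  proof (intro conjI allI impI)
    show "upper_semicont (reinhardt_ext g)" unfolding upper_semicont_def using open_lt by blast
    show "reinhardt_ext g y < \<infinity>" for y by (rule lt)
    have "reinhardt_ext g 1 \<noteq> -\<infinity>" by (subst reinhardt_ext_off_axes[OF g mono]) auto
    then show "\<exists>y. reinhardt_ext g y \<noteq> -\<infinity>" by blast
    fix a b :: "complex ^ 'n"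
    show "upper_semicont (\<lambda>w. reinhardt_ext g (a + w *s b))"
      unfolding upper_semicont_def
    proof
      fix c
      have "continuous_on UNIV (\<lambda>w. a + w *s b)" unfolding vector_scalar_mult_def by (intro continuous_intros)
      from open_vimage[OF open_lt[of c] this]
      show "open {w. reinhardt_ext g (a + w *s b) < c}" by (simp add: vimage_def)
    qed
    show "reinhardt_ext g (a + w *s b) < \<infinity>" for w by (rule lt)
    show "reinhardt_ext g (a + c *s b) \<le> circle_mean (\<lambda>w. reinhardt_ext g (a + w *s b)) c r" for c r
      by (rule mean)
  qed
qed

section \<open>The indicator\<close>

text \<open>
  Through \<open>y\<close> there is a complex line whose points near \<open>y\<close>, except possibly \<open>y\<close> itself, lie off the
  coordinate hyperplanes.  On small circles of this line about \<open>y\<close>, \<open>v = w\<close> is below any number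
  exceeding \<open>w y\<close>, and the mean of \<open>v\<close> over such a circle bounds \<open>v y\<close>.
\<close>

lemma psh_le_of_eq_off_axes:
  fixes v w :: "complex ^ 'n \<Rightarrow> ereal"
  assumes v: "plurisubharmonic v" and w: "plurisubharmonic w"
    and eq: "\<And>y. (\<And>k. y $ k \<noteq> 0) \<Longrightarrow> v y = w y"
  shows "v y \<le> w y"
proof (rule dense_ge)
  fix c assume c: "w y < c"
  have "open {z. w z < c}" using psh_usc[OF w] by (simp add: upper_semicont_def)
  then obtain e where e: "e > 0" "ball y e \<subseteq> {z. w z < c}"
    unfolding open_contains_ball using c by blast
  show "v y \<le> c"
  proof (cases "c = \<infinity>")
    case False
    then obtain s where s: "c = ereal s" using c by (cases c) auto
    define r where "r = e / (2 * CARD('n))"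
    have r: "r > 0" using e by (simp add: r_def)
    define b :: "complex ^ 'n" where "b = (\<chi> k. if y $ k = 0 then of_real r else 0)"
    have "v (y + cis \<theta> *s b) \<le> ereal s" for \<theta>
    proof -
      let ?z = "y + cis \<theta> *s b"
      have "norm (cis \<theta> *s b) \<le> (\<Sum>k\<in>(UNIV::'n set). cmod ((cis \<theta> *s b) $ k))" by (rule norm_le_sum_cmod)
      also have "\<dots> \<le> (\<Sum>k\<in>(UNIV::'n set). r)"
        using r by (intro sum_mono) (simp add: b_def norm_mult)
      also have "\<dots> < e" using e by (simp add: r_def)
      finally have "?z \<in> ball y e" by (simp add: dist_norm)
      then have "w ?z < c" using e by blast
      moreover have "v ?z = w ?z" by (rule eq) (use r in \<open>auto simp: b_def\<close>)
      ultimately show ?thesis using s by simp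
    qed
    then have "v y \<le> ereal (integral {0..2*pi} (\<lambda>_. s) / (2*pi))"
      by (intro psh_le_integral[OF v]) auto
    then show ?thesis by (simp add: s)
  qed simp
qed

lemma psh_indicator_ext:
  assumes u: "u \<in> Lclass"
  shows "plurisubharmonic (reinhardt_ext (psi_real u x))"
    and "(\<And>k. y $ k \<noteq> 0) \<Longrightarrow> reinhardt_ext (psi_real u x) y = psi u x (\<chi> k. ln (cmod (y $ k)))"
  using reinhardt_ext_off_axes[OF psi_convex[OF u] psi_mono[OF u]]
    plurisubharmonic_reinhardt_ext[OF psi_convex[OF u] psi_mono[OF u]]
  by (simp_all add: psi_eq_psi_real[OF u])

lemma local_indicator_eq_reinhardt_ext:
  fixes u :: "complex ^ 'n \<Rightarrow> ereal"
  assumes u: "u \<in> Lclass"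
  shows "local_indicator u x = reinhardt_ext (psi_real u x)"
  unfolding local_indicator_def
proof (rule the_equality, intro conjI allI impI)
  note E = psh_indicator_ext[OF u, where x = x]
  show "plurisubharmonic (reinhardt_ext (psi_real u x))" by (rule E(1))
  show "reinhardt_ext (psi_real u x) y = psi u x (\<chi> k. ln (cmod (y $ k)))" if "\<forall>k. y $ k \<noteq> 0" for y
    by (rule E(2)) (use that in auto)
  fix v assume v: "plurisubharmonic v \<and> (\<forall>y. (\<forall>k. y $ k \<noteq> 0) \<longrightarrow> v y = psi u x (\<chi> k. ln (cmod (y $ k))))"
  then have eq: "v y = reinhardt_ext (psi_real u x) y" if "\<And>k. y $ k \<noteq> 0" for y
    using that E(2)[of y] by auto
  show "v = reinhardt_ext (psi_real u x)"
  proof (rule ext, rule antisym)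
    fix y
    show "v y \<le> reinhardt_ext (psi_real u x) y"
      by (rule psh_le_of_eq_off_axes[OF _ E(1) eq]) (use v in auto)
    show "reinhardt_ext (psi_real u x) y \<le> v y"
      by (rule psh_le_of_eq_off_axes[OF E(1) _ eq[symmetric]]) (use v in auto)
  qed
qed

text \<open>
  The growth bound follows from homogeneity: each \<open>log |y\<^sub>k|\<close> is at most \<open>log\<^sup>+ |y|\<close>, so monotonicity
  gives the bound \<open>\<psi>(1) log\<^sup>+ |y|\<close>, up to a constant that comes from the smoothing with \<open>\<delta> = 1\<close>.
\<close>

lemma local_indicator_in_Lclass:
  fixes u :: "complex ^ 'n \<Rightarrow> ereal"
  assumes u: "u \<in> Lclass"
  shows "local_indicator u x \<in> Lclass"
proof -
  let ?\<psi> = "psi_real u x"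
  have zero: "?\<psi> 0 = 0" using psi_scaleR[OF u, of 0 x 0] by simp
  have one: "0 \<le> ?\<psi> 1" using psi_mono[OF u, of 0 1 x] zero by simp
  have "reinhardt_ext ?\<psi> y \<le> ereal (?\<psi> 1 * max 0 (ln (norm y)) + ?\<psi> 1 * (ln 2 / 2))" for y
  proof -
    define s where "s = max 0 (ln (norm y)) + ln 2 / 2"
    have s: "s \<ge> 0" by (simp add: s_def)
    have "log_vec 1 y $ k \<le> (s *\<^sub>R 1) $ k" for k
    proof -
      have "norm y \<le> exp (max 0 (ln (norm y)))"
      proof (cases "norm y = 0")
        case False
        then have "norm y = exp (ln (norm y))" by simp
        also have "\<dots> \<le> exp (max 0 (ln (norm y)))" by simp
        finally show ?thesis .
      qed simp
      then have "cmod (y $ k) \<le> exp (max 0 (ln (norm y)))"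
        using Finite_Cartesian_Product.norm_nth_le[of y k] by linarith
      then have "(cmod (y $ k))\<^sup>2 \<le> (exp (max 0 (ln (norm y))))\<^sup>2" by (intro power_mono) auto
      moreover have "1 \<le> (exp (max 0 (ln (norm y))))\<^sup>2" by (intro one_le_power) simp
      ultimately have "(cmod (y $ k))\<^sup>2 + 1 \<le> 2 * (exp (max 0 (ln (norm y))))\<^sup>2" by linarith
      also have "\<dots> = exp (2 * s)" by (simp add: s_def exp_add distrib_left flip: exp_double)
      finally have "ln ((cmod (y $ k))\<^sup>2 + 1) \<le> ln (exp (2 * s))"
        by (intro ln_mono) (auto intro: add_nonneg_pos)
      then show ?thesis by (simp add: log_vec_def)
    qed
    then have "?\<psi> (log_vec 1 y) \<le> ?\<psi> (s *\<^sub>R 1)" by (rule psi_mono[OF u])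
    also have "\<dots> = s * ?\<psi> 1" by (rule psi_scaleR[OF u s])
    finally have "?\<psi> (log_vec 1 y) \<le> ?\<psi> 1 * max 0 (ln (norm y)) + ?\<psi> 1 * (ln 2 / 2)"
      by (simp add: s_def algebra_simps)
    moreover have "reinhardt_ext ?\<psi> y \<le> ereal (?\<psi> (log_vec (inverse (real (Suc 0))) y))"
      unfolding reinhardt_ext_def by (rule INF_lower[of 0]) simp
    ultimately show ?thesis by (simp add: order_trans)
  qed
  moreover have "0 \<le> ?\<psi> 1 * (ln 2 / 2)" using one by simp
  ultimately show ?thesis
    unfolding Lclass_def local_indicator_eq_reinhardt_ext[OF u]
    using psh_indicator_ext(1)[OF u] one by blast
qed

text \<open>
  The indicator is constant on every torus about \<open>0\<close>, with value \<open>\<psi>\<close> of the logarithmic radius, and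
  \<open>\<psi>(R t) / R = \<psi>(t)\<close>.
\<close>

lemma psi_local_indicator:
  fixes u :: "complex ^ 'n \<Rightarrow> ereal"
  assumes u: "u \<in> Lclass"
  shows "psi (local_indicator u x) 0 t = psi u x t"
proof -
  have "torus_max (local_indicator u x) 0 s = ereal (psi_real u x s)" for s
  proof -
    have "local_indicator u x z = ereal (psi_real u x s)" if z: "\<forall>k. cmod (z $ k - 0 $ k) = exp (s $ k)" for z
    proof -
      have "z $ k \<noteq> 0" for k using z[rule_format, of k] by auto
      then have "local_indicator u x z = psi u x (\<chi> k. ln (cmod (z $ k)))"
        unfolding local_indicator_eq_reinhardt_ext[OF u] by (rule psh_indicator_ext(2)[OF u])
      also have "(\<chi> k. ln (cmod (z $ k))) = s" using z by (simp add: vec_eq_iff)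
      finally show ?thesis by (simp add: psi_eq_psi_real[OF u])
    qed
    moreover have "(\<chi> k. of_real (exp (s $ k))) \<in> {z :: complex ^ 'n. \<forall>k. cmod (z $ k - 0 $ k) = exp (s $ k)}"
      by simp
    then have "{z :: complex ^ 'n. \<forall>k. cmod (z $ k - 0 $ k) = exp (s $ k)} \<noteq> {}" by blast
    ultimately show ?thesis unfolding torus_max_def by (intro SUP_eq_const) auto
  qed
  then have "log_max (local_indicator u x) 0 s = psi_real u x s" for s by (simp add: log_max_def)
  moreover have "\<forall>\<^sub>F R in at_top. psi_real u x (R *\<^sub>R t) / R = psi_real u x t"
    using eventually_gt_at_top[of 0] by eventually_elim (simp add: psi_scaleR[OF u])
  ultimately have "((\<lambda>R. log_max (local_indicator u x) 0 (R *\<^sub>R t) / R) \<longlongrightarrow> psi_real u x t) at_top"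
    by (simp add: tendsto_eventually)
  then show ?thesis
    using local_indicator_in_Lclass[OF u, of x]
    by (subst psi_eqI) (auto simp: Lclass_def psi_eq_psi_real[OF u])
qed

theorem proposition3:
  fixes u :: "complex ^ 'n \<Rightarrow> ereal" and x :: "complex ^ 'n"
  assumes "u \<in> Lclass"
  shows "(log_type u = log_type (local_indicator u x) \<and>
          log_type (local_indicator u x) = psi u x 1) \<and>
         (\<forall>a :: real ^ 'n. (\<forall>k. a $ k > 0) \<longrightarrow>
            dir_lelong u a = dir_lelong (local_indicator u x) a \<and>
            dir_lelong (local_indicator u x) a = psi u x a) \<and>
         (\<forall>k :: 'n. multitype u k = multitype (local_indicator u x) k \<and>
            multitype (local_indicator u x) k = psi u x (axis k 1))"
proof -
  note I = local_indicator_in_Lclass[OF assms, of x]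
  note psi_I = psi_local_indicator[OF assms, of x]
  show ?thesis
  proof (intro conjI allI impI)
    show "log_type (local_indicator u x) = psi u x 1"
      using log_type_eq_psi[OF I, of 0] psi_I by simp
    then show "log_type u = log_type (local_indicator u x)"
      using log_type_eq_psi[OF assms, of x] by simp
  next
    fix a :: "real ^ 'n" assume "\<forall>k. a $ k > 0"
    then have a: "a $ k > 0" for k by simp
    show "dir_lelong (local_indicator u x) a = psi u x a"
      using dir_lelong_eq_psi[OF I a, of 0] psi_I by simp
    then show "dir_lelong u a = dir_lelong (local_indicator u x) a"
      using dir_lelong_eq_psi[OF assms a, of x] by simp
  next
    fix k
    show "multitype (local_indicator u x) k = psi u x (axis k 1)"
      using multitype_eq_psi[OF I, of k 0] psi_I by simp
    then show "multitype u k = multitype (local_indicator u x) k"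
      using multitype_eq_psi[OF assms, of k x] by simp
  qed
qed

end
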